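(* Let $D_n$ be the dipole with $n$ edges. Then $\gamma_{avg}(D_1)=\gamma_{avg}(D_2)=0$, and for every $n\geq 3$, $$\gamma_{avg}(D_n)=\sum_{m=4}^{n+1}\frac{ \big(4 (-1)^m m^2+m^2-12 (-1)^m m-5 m+6 (-1)^m+6\big)\,(n-m+2)}{2(m-3) (m-2) (m-1) m}.$$ In particular, $$\gamma_{avg}(D_n)=\frac{n-\ln n-c }{2}+o(1)\quad (n\to\infty),$$ where $c\approx 0.5772$ is the Euler constant.
   Context: Graphs may have loops and multiple edges. The dipole $D_n$ is the graph with two vertices joined by $n$ parallel edges (and no loops). For a connected graph $G$, let $g_k(G)$ denote the number of (labeled) cellular embeddings of $G$ into the closed orientable surface of genus $k$ (equivalently, the number of rotation systems of $G$ whose induced embedding has genus $k$; an embedding is cellular if every face is homeomorphic to an open disc). The genus polynomial is $\Gamma_G(x)=\sum_{k\geq 0} g_k(G)x^k$, and the average genus is $\gamma_{avg}(G)=\Gamma_G'(1)/\Gamma_G(1)=\sum_{k\ge 0} k\, g_k(G)/\Gamma_G(1)$, i.e. the expected genus of a uniformly random labeled 2-cell orientable embedding of $G$. *)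

theory Defs
  imports
    "HOL-Analysis.Harmonic_Numbers"
    "HOL-Library.Landau_Symbols"
    "HOL-Computational_Algebra.Polynomial"
    "HOL-Combinatorics.Orbits"
    "Graph_Theory.Graph_Theory"
begin

text \<open>
  An undirected multigraph (loops and parallel edges allowed) is represented by a
  \<^type>\<open>pre_digraph\<close> with one arc per edge; the direction of the arc is an arbitrary choice and
  only serves to name the two ends of the edge.  An edge \<open>e\<close> has the two darts (half-edges)
  \<open>(e, False)\<close> and \<open>(e, True)\<close>, so a loop contributes two distinct darts at its vertex.
\<close>

definition darts :: "('a, 'e) pre_digraph \<Rightarrow> ('e \<times> bool) set" where
  "darts G = arcs G \<times> UNIV"

definition dart_vertex :: "('a, 'e) pre_digraph \<Rightarrow> 'e \<times> bool \<Rightarrow> 'a" where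
  "dart_vertex G d = (if snd d then head G (fst d) else tail G (fst d))"

definition dart_rev :: "'e \<times> bool \<Rightarrow> 'e \<times> bool" where
  "dart_rev d = (fst d, \<not> snd d)"

definition darts_at :: "('a, 'e) pre_digraph \<Rightarrow> 'a \<Rightarrow> ('e \<times> bool) set" where
  "darts_at G v = {d \<in> darts G. dart_vertex G d = v}"

text \<open>
  A rotation system is a choice of a cyclic order of the darts at every vertex, given by its
  successor function.  Requiring \<open>permutes\<close> makes the successor function the identity outside
  the darts, so that distinct functions are distinct rotation systems.
\<close>

definition rotation_systems :: "('a, 'e) pre_digraph \<Rightarrow> ('e \<times> bool \<Rightarrow> 'e \<times> bool) set" where
  "rotation_systems G =
     {\<rho>. \<rho> permutes darts G \<and>
          (\<forall>v\<in>verts G. darts_at G v \<noteq> {} \<longrightarrow> cyclic_on \<rho> (darts_at G v))}"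

text \<open>
  Faces of the induced embedding are the orbits of the face-tracing permutation.  The connected
  graph without edges is a single vertex; its embedding in the sphere has one face, whose boundary
  walk traverses no dart.
\<close>

definition faces ::
    "('a, 'e) pre_digraph \<Rightarrow> ('e \<times> bool \<Rightarrow> 'e \<times> bool) \<Rightarrow> ('e \<times> bool) set set" where
  "faces G \<rho> = (if arcs G = {} then {{}} else (\<lambda>d. orbit (\<rho> \<circ> dart_rev) d) ` darts G)"

definition euler_char :: "('a, 'e) pre_digraph \<Rightarrow> ('e \<times> bool \<Rightarrow> 'e \<times> bool) \<Rightarrow> int" where
  "euler_char G \<rho> = int (card (verts G)) - int (card (arcs G)) + int (card (faces G \<rho>))"

text \<open>
  For connected \<open>G\<close>, the closed orientable surface obtained by gluing discs along the faces has
  genus \<open>k\<close> iff its Euler characteristic is \<open>2 - 2k\<close>.  The following notions are meant for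
  finite connected \<open>G\<close> only.
\<close>

definition genus_count :: "('a, 'e) pre_digraph \<Rightarrow> nat \<Rightarrow> nat" where
  "genus_count G k = card {\<rho> \<in> rotation_systems G. euler_char G \<rho> = 2 - 2 * int k}"

definition genus_poly :: "('a, 'e) pre_digraph \<Rightarrow> real poly" where
  "genus_poly G = (\<Sum>k | genus_count G k \<noteq> 0. monom (real (genus_count G k)) k)"

definition average_genus :: "('a, 'e) pre_digraph \<Rightarrow> real" where
  "average_genus G = poly (pderiv (genus_poly G)) 1 / poly (genus_poly G) 1"

definition dipole :: "nat \<Rightarrow> (bool, nat) pre_digraph" where
  "dipole n = \<lparr>verts = UNIV, arcs = {..<n}, tail = (\<lambda>_. False), head = (\<lambda>_. True)\<rparr>"


lemma finite_genus_count_support: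
  assumes "finite (arcs G)"
  shows "finite {k. genus_count G k \<noteq> 0}"
proof -
  have "finite (darts G)"
    using assms by (simp add: darts_def)
  then have fin: "finite (rotation_systems G)"
    by (rule finite_subset[OF _ finite_permutations, rotated])
      (auto simp: rotation_systems_def)
  have "{k. genus_count G k \<noteq> 0} \<subseteq> (\<lambda>\<rho>. nat ((2 - euler_char G \<rho>) div 2)) ` rotation_systems G"
  proof
    fix k assume "k \<in> {k. genus_count G k \<noteq> 0}"
    then have "{\<rho> \<in> rotation_systems G. euler_char G \<rho> = 2 - 2 * int k} \<noteq> {}"
      unfolding genus_count_def by (metis (lifting) card.empty mem_Collect_eq)
    then obtain \<rho> where "\<rho> \<in> rotation_systems G" "euler_char G \<rho> = 2 - 2 * int k"
      by blast
    then show "k \<in> (\<lambda>\<rho>. nat ((2 - euler_char G \<rho>) div 2)) ` rotation_systems G"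
      by (intro image_eqI[of _ _ \<rho>]) auto
  qed
  then show ?thesis
    using fin finite_surj by blast
qed

lemma coeff_genus_poly:
  assumes "finite (arcs G)"
  shows "coeff (genus_poly G) k = real (genus_count G k)"
  using finite_genus_count_support[OF assms]
  by (simp add: genus_poly_def coeff_sum sum.delta)

lemma fin_digraph_dipole: "fin_digraph (dipole n)"
  by unfold_locales (auto simp: dipole_def)

lemma connected_dipole:
  assumes "n \<ge> 1"
  shows "connected (dipole n)"
proof -
  interpret fin_digraph "dipole n" by (rule fin_digraph_dipole)
  let ?S = "mk_symmetric (dipole n)"
  interpret S: pair_wf_digraph ?S ..
  have arc: "(False, True) \<in> parcs ?S" "(True, False) \<in> parcs ?S"
    using assms by (auto simp: parcs_mk_symmetric dipole_def lessThan_empty_iff)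
  have verts: "pverts ?S = UNIV"
    by (simp add: dipole_def)
  have "u \<rightarrow>\<^sup>*\<^bsub>with_proj ?S\<^esub> v" for u v
  proof (cases "u = v")
    case True
    then show ?thesis
      using verts by (simp add: S.reachable_refl)
  next
    case False
    then have "(u, v) \<in> parcs ?S"
      using arc by (cases u; cases v) simp_all
    then show ?thesis
      by (intro S.reachable_adjI) simp
  qed
  then show ?thesis
    by (auto simp: connected_def strongly_connected_def dipole_def)
qed

end

theory Submission
  imports Defs
begin

text \<open>
  A rotation system of the dipole is a pair of \<open>n\<close>-cycles \<open>a\<close>, \<open>b\<close>, and its faces are the cycles
  of \<open>a \<circ> b\<close>, so one needs the expected number of cycles of a product of two random
  \<open>n\<close>-cycles.  Appending a point to \<open>a\<close> turns \<open>a \<circ> b\<close> into a product of an \<open>(n + 1)\<close>-cycle and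
  an \<open>n\<close>-cycle without changing the number of cycles.  Such a product is uniformly distributed on
  the odd permutations of \<open>n + 1\<close> points: each odd permutation of \<open>N\<close> points has
  \<open>2 (N - 2)!\<close> factorisations into an \<open>N\<close>-cycle and an \<open>(N - 1)\<close>-cycle, by induction on \<open>N\<close>.
  Averaging the number of cycles over the odd permutations gives the expected number of faces
  \<open>H\<^bsub>n+1\<^esub> + (-1)\<^sup>n / (n (n + 1))\<close>.
\<close>

text \<open>Products of two n-cycles are not uniform on the even permutations: for n = 3 the
  identity arises twice as often as each 3-cycle. This is why a point is added to one factor only.
  For lengths N and N - 1 uniformity is forced by characters, since only the trivial and the sign
  character are nonzero on both classes. The proof avoids characters by deleting one point from both
  factors: at a moved point exactly N - 2 deletions are admissible, whatever the cycle type, so the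
  count cannot see which odd permutation is factored. The constant is the total (N - 1)! * N * (N -
  2)! divided by the N!/2 odd permutations. The alternating term of the mean comes from selecting
  the odd permutations by (1 - sign) / 2.\<close>

hide_const (open) Finite_Cartesian_Product.transpose


section \<open>Cycles and insertion of a point\<close>

text \<open>The set is explicit because its fixed points count as cycles.\<close>

definition num_cycles :: "'a set \<Rightarrow> ('a \<Rightarrow> 'a) \<Rightarrow> nat" where
  "num_cycles S p = card (orbit p ` S)"

definition full_cycles :: "'a set \<Rightarrow> ('a \<Rightarrow> 'a) set" where
  "full_cycles S = {p. p permutes S \<and> cyclic_on p S}"

lemma comp_transpose:
  assumes "inj p"
  shows "p \<circ> transpose a b = transpose (p a) (p b) \<circ> p"
proof
  fix z
  show "(p \<circ> transpose a b) z = (transpose (p a) (p b) \<circ> p) z"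
  proof (cases "z = a \<or> z = b")
    case False
    then show ?thesis using assms by (simp add: inj_eq)
  qed auto
qed

lemma finite_full_cycles: "finite S \<Longrightarrow> finite (full_cycles S)"
  by (rule finite_subset[OF _ finite_permutations[of S]]) (auto simp: full_cycles_def)

lemma permutes_transpose_insert:
  assumes "p permutes S" "x \<in> insert f S"
  shows "transpose f x \<circ> p permutes insert f S"
  using assms by (intro permutes_compose[OF permutes_subset[OF assms(1)]] permutes_swap_id) auto

text \<open>The map \<open>transpose f x \<circ> p\<close> puts \<open>f\<close> into the arrow of
  \<open>p\<close> that ends at \<open>x\<close>: z -> x becomes z -> f -> x. Every old cycle
  survives, at most with a detour through \<open>f\<close>.\<close>

lemma orbit_transpose_insert:
  assumes "p permutes S" "f \<notin> S" "x \<in> S" "y \<in> S"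
  shows "orbit (transpose f x \<circ> p) y \<inter> S = orbit p y"
proof -
  let ?q = "transpose f x \<circ> p"
  have pf: "p f = f" using assms by (simp add: permutes_not_in)
  have sub: "orbit p y \<subseteq> S" using assms permutes_orbit_subset by metis
  have qS: "?q z = (if p z = x then f else p z)" if "z \<in> S" for z
  proof -
    have "p z \<noteq> f" using that assms by (metis permutes_in_image)
    then show ?thesis by (auto simp: Transposition.transpose_def)
  qed
  have qf: "?q f = x" using pf by (simp add: Transposition.transpose_def)
  have nxt: "p z \<in> orbit ?q y" if z: "z = y \<or> z \<in> orbit ?q y" "z \<in> S" for z
  proof -
    have *: "?q z \<in> orbit ?q y" using z(1) by (metis orbit.base orbit.step)
    show ?thesis
    proof (cases "p z = x")
      case True
      then have "f \<in> orbit ?q y" using * qS[OF z(2)] by simp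
      then have "?q f \<in> orbit ?q y" by (rule orbit.step)
      then show ?thesis using True qf by simp
    next
      case False
      then show ?thesis using * qS[OF z(2)] by simp
    qed
  qed
  have "z \<in> orbit ?q y" if "z \<in> orbit p y" for z
    using that
  proof induction
    case base
    show ?case using nxt assms by blast
  next
    case (step z)
    then show ?case using nxt sub by blast
  qed
  \<comment> \<open>The invariant also covers the detour: on reaching \<open>f\<close> it must be
    known that the next point \<open>x\<close> lies on the old orbit.\<close>
  moreover have "(z \<in> S \<longrightarrow> z \<in> orbit p y) \<and> (z = f \<longrightarrow> x \<in> orbit p y) \<and> z \<in> insert f S"
    if "z \<in> orbit ?q y" for z
    using that
  proof induction
    case base
    have "p y \<in> orbit p y" by (rule orbit.base)
    then show ?case using qS[OF assms(4)] assms(2) sub by auto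
  next
    case (step z)
    show ?case
    proof (cases "z = f")
      case True
      then show ?thesis using step qf assms by auto
    next
      case False
      then have "z \<in> S" "z \<in> orbit p y" using step by auto
      moreover from this have "p z \<in> orbit p y" by (intro orbit.step)
      ultimately show ?thesis using qS[of z] assms(2) sub by auto
    qed
  qed
  ultimately show ?thesis using sub by blast
qed

text \<open>The point \<open>f\<close> joins the cycle of \<open>x\<close>, so every new cycle meets
  \<open>S\<close> and is determined by its trace there; the traces are the old cycles.\<close>

lemma num_cycles_transpose_insert:
  assumes "finite S" "p permutes S" "f \<notin> S" "x \<in> S"
  shows "num_cycles (insert f S) (transpose f x \<circ> p) = num_cycles S p"
proof -
  let ?q = "transpose f x \<circ> p"
  have perm: "?q permutes insert f S" using assms by (intro permutes_transpose_insert) auto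
  then have pq: "permutation ?q" using assms(1) permutation_permutes by blast
  have qf: "?q f = x" using assms by (simp add: permutes_not_in)
  then have "orbit ?q f = orbit ?q x" using permutation_orbit_step[OF pq, of f] by simp
  then have 1: "orbit ?q ` insert f S = orbit ?q ` S" using assms(4) by auto
  have 2: "orbit p ` S = (\<lambda>X. X \<inter> S) ` (orbit ?q ` S)"
    unfolding image_image using orbit_transpose_insert[OF assms(2-4)] by (intro image_cong) auto
  have "inj_on (\<lambda>X. X \<inter> S) (orbit ?q ` S)"
  proof (rule inj_onI, clarify)
    fix y z assume yz: "y \<in> S" "z \<in> S" and eq: "orbit ?q y \<inter> S = orbit ?q z \<inter> S"
    have "y \<in> orbit ?q z"
      using eq yz permutation_self_in_orbit[OF pq, of y] by blast
    then show "orbit ?q y = orbit ?q z"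
      using cyclic_on_orbit'[OF pq, of z] by (metis orbit_cyclic_eq3)
  qed
  then show ?thesis
    unfolding num_cycles_def 1 2 by (simp add: card_image)
qed

lemma num_cycles_insert_fixed:
  assumes "finite S" "p permutes S" "f \<notin> S"
  shows "num_cycles (insert f S) p = Suc (num_cycles S p)"
proof -
  have "orbit p f = {f}" using assms by (simp add: orbit_eq_singleton_iff permutes_not_in)
  moreover have "{f} \<notin> orbit p ` S" 
    using assms permutes_orbit_subset[OF assms(2)] by blast
  ultimately show ?thesis using assms(1) by (simp add: num_cycles_def)
qed

text \<open>Being a full cycle becomes a count, so that \<open>num_cycles_transpose_insert\<close>
  transfers it between \<open>S\<close> and \<open>insert f S\<close>.\<close>

lemma cyclic_on_iff_num_cycles:
  assumes "finite S" "p permutes S"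
  shows "cyclic_on p S \<longleftrightarrow> num_cycles S p = 1"
proof
  assume "cyclic_on p S"
  then have "orbit p ` S = {S}" 
    unfolding cyclic_on_alldef by auto
  then show "num_cycles S p = 1" by (simp add: num_cycles_def)
next
  assume "num_cycles S p = 1"
  then obtain X where X: "orbit p ` S = {X}" 
    unfolding num_cycles_def using card_1_singletonE by blast
  then have orb: "orbit p s = X" if "s \<in> S" for s using that by auto
  have "X \<in> orbit p ` S" using X by simp
  then obtain s where s: "s \<in> S" "orbit p s = X" by auto
  have pp: "permutation p" using assms permutation_permutes by metis
  have "y \<in> X" if "y \<in> S" for y
    using orb[OF that] permutation_self_in_orbit[OF pp, of y] by simp
  then have "S = orbit p s" using s permutes_orbit_subset[OF assms(2) s(1)] by auto
  then show "cyclic_on p S" using s cyclic_on_def by metis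
qed

lemma transpose_comp_full_cycles_iff:
  assumes "finite S" "p permutes S" "f \<notin> S" "x \<in> S"
  shows "transpose f x \<circ> p \<in> full_cycles (insert f S) \<longleftrightarrow> p \<in> full_cycles S"
proof -
  have "transpose f x \<circ> p permutes insert f S" using assms by (intro permutes_transpose_insert) auto
  then show ?thesis
    using assms num_cycles_transpose_insert[OF assms]
    by (simp add: full_cycles_def cyclic_on_iff_num_cycles)
qed

text \<open>Inserting \<open>f\<close> after \<open>y\<close> is inserting it before
  \<open>p y\<close>.\<close>

lemma comp_transpose_full_cycles_iff:
  assumes "finite S" "p permutes S" "f \<notin> S" "y \<in> S"
  shows "p \<circ> transpose f y \<in> full_cycles (insert f S) \<longleftrightarrow> p \<in> full_cycles S"
proof -
  have "p f = f" using assms by (simp add: permutes_not_in)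
  then have "p \<circ> transpose f y = transpose f (p y) \<circ> p"
    using permutes_inj[OF assms(2)] by (simp add: comp_transpose)
  moreover have "p y \<in> S" using assms by (simp add: permutes_in_image)
  ultimately show ?thesis using transpose_comp_full_cycles_iff assms by metis
qed

lemma permutes_delete:
  assumes "p permutes insert f S" "p f = f"
  shows "p permutes S"
  using assms by (intro permutes_superset[OF assms(1)]) auto

text \<open>A permutation \<open>q\<close> that moves \<open>f\<close> arises by insertion in one
  way: \<open>x\<close> must be \<open>q f\<close>, and composing with the same transposition again
  takes \<open>f\<close> out.\<close>

lemma bij_betw_transpose_insert:
  assumes "f \<notin> S"
  shows "bij_betw (\<lambda>(x, p). transpose f x \<circ> p) (S \<times> {p. p permutes S})
    {q. q permutes insert f S \<and> q f \<noteq> f}"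
proof (rule bij_betw_byWitness[where f' = "\<lambda>q. (q f, transpose f (q f) \<circ> q)"])
  show "\<forall>a\<in>S \<times> {p. p permutes S}.
      (\<lambda>q. (q f, transpose f (q f) \<circ> q)) ((\<lambda>(x, p). transpose f x \<circ> p) a) = a"
    using assms by (auto simp: permutes_not_in fun_eq_iff)
  show "\<forall>q\<in>{q. q permutes insert f S \<and> q f \<noteq> f}. (\<lambda>(x, p). transpose f x \<circ> p) (q f, transpose f (q f) \<circ> q) = q"
    by (auto simp: fun_eq_iff)
  show "(\<lambda>(x, p). transpose f x \<circ> p) ` (S \<times> {p. p permutes S}) \<subseteq> {q. q permutes insert f S \<and> q f \<noteq> f}"
    using assms by (auto simp: permutes_not_in intro!: permutes_transpose_insert)
  show "(\<lambda>q. (q f, transpose f (q f) \<circ> q)) ` {q. q permutes insert f S \<and> q f \<noteq> f} \<subseteq> S \<times> {p. p permutes S}"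
  proof (intro image_subsetI)
    fix q assume "q \<in> {q. q permutes insert f S \<and> q f \<noteq> f}"
    then have q: "q permutes insert f S" "q f \<noteq> f" by auto
    then have "q f \<in> S" by (metis insertCI insertE permutes_in_image)
    moreover have "transpose f (q f) \<circ> q permutes insert f S"
      using q \<open>q f \<in> S\<close> by (intro permutes_compose permutes_swap_id) auto
    then have "transpose f (q f) \<circ> q permutes S" by (rule permutes_delete) simp
    ultimately show "(q f, transpose f (q f) \<circ> q) \<in> S \<times> {p. p permutes S}" by simp
  qed
qed

lemma full_cycles_no_fixpoint:
  assumes "p \<in> full_cycles (insert f S)" "f \<notin> S" "S \<noteq> {}"
  shows "p f \<noteq> f"
proof
  assume "p f = f"
  then have "orbit p f = {f}" by (simp add: orbit_eq_singleton_iff)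
  moreover have "orbit p f = insert f S"
    using assms by (intro orbit_cyclic_eq3) (auto simp: full_cycles_def)
  ultimately show False using assms by auto
qed

lemma full_cycles_singleton: "full_cycles {x} = {id}"
  using orbit_eq_singleton_iff[of id x] by (auto simp: full_cycles_def cyclic_on_def)

text \<open>A full cycle on at least two points moves \<open>f\<close>, hence comes from inserting
  \<open>f\<close> before one of the \<open>card S\<close> points of a smaller full cycle.\<close>

lemma card_full_cycles:
  assumes "finite S" "S \<noteq> {}"
  shows "card (full_cycles S) = fact (card S - 1)"
  using assms
proof (induction rule: finite_ne_induct)
  case (singleton x)
  show ?case by (simp add: full_cycles_singleton)
next
  case (insert f S)
  have "bij_betw (\<lambda>(x, p). transpose f x \<circ> p) (S \<times> full_cycles S) (full_cycles (insert f S))"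
  proof (rule bij_betw_subset[OF bij_betw_transpose_insert])
    show "f \<notin> S" by fact
    show "S \<times> full_cycles S \<subseteq> S \<times> {p. p permutes S}" by (auto simp: full_cycles_def)
    let ?h = "\<lambda>(x, p). transpose f x \<circ> p"
    have im: "?h ` (S \<times> {p. p permutes S}) = {q. q permutes insert f S \<and> q f \<noteq> f}"
      using bij_betw_transpose_insert[OF \<open>f \<notin> S\<close>] by (simp add: bij_betw_def)
    show "?h ` (S \<times> full_cycles S) = full_cycles (insert f S)"
    proof (intro equalityI subsetI)
      fix q assume "q \<in> ?h ` (S \<times> full_cycles S)"
      then obtain x p where xp: "x \<in> S" "p \<in> full_cycles S" "q = transpose f x \<circ> p" by auto
      then have "p permutes S" by (simp add: full_cycles_def)
      with xp show "q \<in> full_cycles (insert f S)"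
        using transpose_comp_full_cycles_iff insert.hyps by metis
    next
      fix q assume q: "q \<in> full_cycles (insert f S)"
      then have "q \<in> {q. q permutes insert f S \<and> q f \<noteq> f}"
        using full_cycles_no_fixpoint[OF q] insert.hyps by (auto simp: full_cycles_def)
      then have "q \<in> ?h ` (S \<times> {p. p permutes S})" unfolding im .
      then obtain x p where xp: "x \<in> S" "p permutes S" "q = transpose f x \<circ> p" by auto
      then have "p \<in> full_cycles S"
        using transpose_comp_full_cycles_iff insert.hyps q by metis
      with xp show "q \<in> ?h ` (S \<times> full_cycles S)" by auto
    qed
  qed
  then have "card (full_cycles (insert f S)) = card S * card (full_cycles S)"
    by (simp add: bij_betw_same_card[symmetric] card_cartesian_product)
  also have "\<dots> = fact (card (insert f S) - 1)"
    using insert by (cases "card S") (auto simp: card_insert_if)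
  finally show ?case .
qed

section \<open>Factorisations into long cycles\<close>

text \<open>Multiplying \<open>p\<close> by a transposition moving \<open>f\<close> on both sides, chosen so that the result
  fixes \<open>f\<close>.  For \<open>y = f\<close> this erases \<open>f\<close> from its cycle.\<close>
definition bypass :: "'a \<Rightarrow> 'a \<Rightarrow> ('a \<Rightarrow> 'a) \<Rightarrow> 'a \<Rightarrow> 'a" where
  "bypass f y p = transpose f (p y) \<circ> p \<circ> transpose f y"

definition num_fact :: "'a set \<Rightarrow> ('a \<Rightarrow> 'a) \<Rightarrow> nat" where
  "num_fact S p = card {(a, b). a \<in> full_cycles S \<and> b \<in> full_cycles S \<and> a \<circ> b = p}"

text \<open>This is the number of factorisations of \<open>p\<close> into a full cycle on \<open>S\<close> and a cycle on
  \<open>S - {f}\<close> for some \<open>f\<close>: left multiplication by \<open>transpose f (p f)\<close> turns the former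
  into a full cycle on \<open>S - {f}\<close>.\<close>
definition num_fact1 :: "'a set \<Rightarrow> ('a \<Rightarrow> 'a) \<Rightarrow> nat" where
  "num_fact1 S p = (\<Sum>f | f \<in> S \<and> p f \<noteq> f. num_fact (S - {f}) (bypass f f p))"

lemma bypass_same: "bypass f f p = transpose f (p f) \<circ> p"
  by (simp add: bypass_def)

lemma bypass_self [simp]: "bypass f y p f = f"
  by (simp add: bypass_def)

lemma bypass_permutes:
  assumes "p permutes S" "f \<in> S" "y \<in> S"
  shows "bypass f y p permutes S - {f}"
proof (rule permutes_superset)
  show "bypass f y p permutes S"
    unfolding bypass_def using assms
    by (intro permutes_compose permutes_swap_id) (auto simp: permutes_in_image)
qed auto

text \<open>The summand \<open>y\<close> collects the factorisations \<open>p = a \<circ> b\<close> with \<open>b y = f\<close>; then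
  \<open>a f = p y\<close>, and \<open>f\<close> can be erased from both cycles.\<close>
lemma num_fact_rec:
  assumes fin: "finite S" and p: "p permutes S" and f: "f \<in> S" and ne: "S - {f} \<noteq> {}"
  shows "num_fact S p = (\<Sum>y | y \<in> S - {f} \<and> p y \<noteq> f. num_fact (S - {f}) (bypass f y p))"
proof -
  define S' where "S' = S - {f}"
  have S: "S = insert f S'" "f \<notin> S'" "finite S'" using f fin by (auto simp: S'_def)
  have nofix: "b f \<noteq> f" if "b \<in> full_cycles S" for b
    using full_cycles_no_fixpoint[of b f "S - {f}"] that ne f by (simp add: insert_absorb)
  have yS: "y \<in> S'" if "y \<in> S" "y \<noteq> f" for y using that by (simp add: S'_def)
  define X where "X y = {(a, b). a \<in> full_cycles S \<and> b \<in> full_cycles S \<and> a \<circ> b = p \<and> b y = f}" for y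
  let ?X = "{(a, b). a \<in> full_cycles S \<and> b \<in> full_cycles S \<and> a \<circ> b = p}"
  have finX: "finite ?X"
    by (rule finite_subset[of _ "full_cycles S \<times> full_cycles S"])
      (auto simp: finite_full_cycles fin)
  have "?X \<subseteq> (\<Union>y\<in>S'. X y)"
  proof clarify
    fix a b assume ab: "a \<in> full_cycles S" "b \<in> full_cycles S" "p = a \<circ> b"
    then have b: "b permutes S" by (simp add: full_cycles_def)
    define y where "y = inv b f"
    have y: "b y = f" unfolding y_def by (rule permutes_inverses(1)[OF b])
    then have "y \<in> S" using permutes_in_image[OF b, of y] f by simp
    moreover have "y \<noteq> f" using y nofix[OF ab(2)] by auto
    ultimately show "(a, b) \<in> (\<Union>y\<in>S'. X y)" 
      using y ab yS by (auto simp: X_def)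
  qed
  then have X: "?X = (\<Union>y\<in>S'. X y)" by (auto simp: X_def)
  have finXy: "finite (X y)" for y by (rule finite_subset[OF _ finX]) (auto simp: X_def)
  have disj: "X y \<inter> X z = {}" if "y \<noteq> z" for y z
  proof -
    have False if "(a, b) \<in> X y" "(a, b) \<in> X z" for a b
    proof -
      have "b y = b z" "inj b" using that permutes_inj[of b S] by (auto simp: X_def full_cycles_def)
      then show False using \<open>y \<noteq> z\<close> by (simp add: inj_eq)
    qed
    then show ?thesis by auto
  qed
  have "num_fact S p = card (\<Union>y\<in>S'. X y)" by (simp only: num_fact_def X)
  also have "\<dots> = (\<Sum>y\<in>S'. card (X y))"
    using S(3) finXy disj by (intro card_UN_disjoint) blast+
  also have "\<dots> = (\<Sum>y\<in>S'. if p y \<noteq> f then num_fact S' (bypass f y p) else 0)"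
  proof (rule sum.cong[OF refl])
    fix y assume y: "y \<in> S'"
    show "card (X y) = (if p y \<noteq> f then num_fact S' (bypass f y p) else 0)"
    proof (cases "p y = f")
      case True
      have "X y = {}"
      proof -
        have False if ab: "(a, b) \<in> X y" for a b
        proof -
          from ab have a: "a \<in> full_cycles S" and "(a \<circ> b) y = p y" "b y = f" by (auto simp: X_def)
          then have "a f = f" using True by simp
          then show False using nofix[OF a] by simp
        qed
        then show ?thesis by auto
      qed
      then show ?thesis using True by simp
    next
      case False
      have "p y \<in> S" using y permutes_in_image[OF p, of y] by (simp add: S'_def)
      with False have x: "p y \<in> S'" by (simp add: yS)
      let ?Y = "{(a, b). a \<in> full_cycles S' \<and> b \<in> full_cycles S' \<and> a \<circ> b = bypass f y p}"
      \<comment> \<open>Composing with a transposition is an involution, so one map both erases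
        \<open>f\<close> from the two cycles and reinserts it, before \<open>p y\<close> in
        \<open>a\<close> and after \<open>y\<close> in \<open>b\<close>.\<close>
      let ?h = "\<lambda>(a, b). (transpose f (p y) \<circ> a, b \<circ> transpose f y)"
      have hh: "?h (?h ab) = ab" for ab by (cases ab) (simp add: fun_eq_iff)
      have "bij_betw ?h (X y) ?Y"
      proof (rule bij_betw_byWitness[where f' = ?h])
        show "\<forall>ab\<in>X y. ?h (?h ab) = ab" "\<forall>ab\<in>?Y. ?h (?h ab) = ab" using hh by blast+
        show "?h ` X y \<subseteq> ?Y"
        proof clarify
          fix a b assume "(a, b) \<in> X y"
          then have a: "a \<in> full_cycles S" and b: "b \<in> full_cycles S" and ab: "a \<circ> b = p" "b y = f"
            by (auto simp: X_def)
          have af: "a f = p y" using ab by auto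
          have "transpose f (p y) \<circ> a permutes S" "b \<circ> transpose f y permutes S"
            using a b x y f by (auto intro!: permutes_compose permutes_swap_id simp: full_cycles_def S'_def)
          note perms = this[unfolded S(1)]
          have pm: "transpose f (p y) \<circ> a permutes S'" "b \<circ> transpose f y permutes S'"
            using permutes_delete[OF perms(1)] permutes_delete[OF perms(2)] af ab(2) by simp_all
          have "transpose f (p y) \<circ> (transpose f (p y) \<circ> a) = a" "b \<circ> transpose f y \<circ> transpose f y = b"
            by (simp_all add: fun_eq_iff)
          then have "transpose f (p y) \<circ> a \<in> full_cycles S'" "b \<circ> transpose f y \<in> full_cycles S'"
            using transpose_comp_full_cycles_iff[OF S(3) pm(1) S(2) x]
              comp_transpose_full_cycles_iff[OF S(3) pm(2) S(2) y] a b unfolding S(1)[symmetric] by simp_all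
          moreover have "transpose f (p y) \<circ> a \<circ> (b \<circ> transpose f y) = bypass f y p"
            using ab by (auto simp: bypass_def)
          ultimately show "transpose f (p y) \<circ> a \<in> full_cycles S' \<and> b \<circ> transpose f y \<in> full_cycles S' \<and>
            transpose f (p y) \<circ> a \<circ> (b \<circ> transpose f y) = bypass f y p" by blast
        qed
        show "?h ` ?Y \<subseteq> X y"
        proof clarify
          fix a b assume a: "a \<in> full_cycles S'" and b: "b \<in> full_cycles S'" 
            and ab: "a \<circ> b = bypass f y p"
          have pm: "a permutes S'" "b permutes S'" using a b by (auto simp: full_cycles_def)
          have "transpose f (p y) \<circ> a \<in> full_cycles S" "b \<circ> transpose f y \<in> full_cycles S"
            using transpose_comp_full_cycles_iff[OF S(3) pm(1) S(2) x]
              comp_transpose_full_cycles_iff[OF S(3) pm(2) S(2) y] a b unfolding S(1)[symmetric] by simp_all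
          moreover have "(transpose f (p y) \<circ> a) \<circ> (b \<circ> transpose f y) = p"
          proof -
            have "(transpose f (p y) \<circ> a) \<circ> (b \<circ> transpose f y) = transpose f (p y) \<circ> (a \<circ> b) \<circ> transpose f y"
              by (simp add: comp_assoc)
            then show ?thesis unfolding ab by (simp add: bypass_def fun_eq_iff)
          qed
          moreover have "b f = f" using pm S(2) by (simp add: permutes_not_in)
          ultimately show "(transpose f (p y) \<circ> a, b \<circ> transpose f y) \<in> X y"
            by (simp add: X_def)
        qed
      qed
      then show ?thesis using False by (simp add: num_fact_def bij_betw_same_card)
    qed
  qed
  finally show ?thesis
    using S(3) by (simp add: S'_def[symmetric] sum.inter_filter)
qed

lemma full_cycles_conj:
  assumes "a \<in> full_cycles S"
  shows "transpose u v \<circ> a \<circ> transpose u v \<in> full_cycles (transpose u v ` S)"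
proof -
  let ?t = "transpose u v"
  have a: "a permutes S" "cyclic_on a S" using assms by (auto simp: full_cycles_def)
  have "cyclic_on (?t \<circ> a \<circ> ?t) (?t ` S)"
    using a(2) by (rule cyclic_on_image) simp
  moreover have "?t \<circ> a \<circ> ?t permutes ?t ` S"
  proof (rule bij_imp_permutes)
    have 1: "bij_betw ?t S (?t ` S)" by (simp add: bij_betw_def)
    have 2: "bij_betw ?t (?t ` S) S" by (simp add: bij_betw_def image_comp)
    show "bij_betw (?t \<circ> a \<circ> ?t) (?t ` S) (?t ` S)"
      using bij_betw_trans[OF bij_betw_trans[OF 2 permutes_imp_bij[OF a(1)]] 1]
      by (simp add: comp_assoc)
    fix x assume "x \<notin> ?t ` S"
    then have "?t x \<notin> S" by (simp add: in_transpose_image_iff)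
    then show "(?t \<circ> a \<circ> ?t) x = x" using a by (simp add: permutes_not_in)
  qed
  ultimately show ?thesis by (simp add: full_cycles_def)
qed

text \<open>Conjugating both factors maps factorisations to factorisations. This compares counts on
  different ground sets, \<open>T - {y}\<close> and \<open>T - {p g}\<close> in
  \<open>num_fact1_rec\<close>.\<close>

lemma num_fact_conj:
  "num_fact (transpose u v ` S) (transpose u v \<circ> p \<circ> transpose u v) = num_fact S p"
proof -
  let ?t = "transpose u v"
  let ?c = "\<lambda>a. ?t \<circ> a \<circ> ?t"
  let ?h = "\<lambda>(a, b). (?c a, ?c b)"
  let ?Y = "\<lambda>S p. {(a, b). a \<in> full_cycles S \<and> b \<in> full_cycles S \<and> a \<circ> b = p}"
  have cc: "?c (?c a) = a" for a by (simp add: fun_eq_iff)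
  have hh: "?h (?h ab) = ab" for ab using cc by (cases ab) simp
  have tt: "?t ` ?t ` S = S" for S by (simp add: image_comp)
  have sub: "?h ` ?Y S p \<subseteq> ?Y (?t ` S) (?c p)" for S p
    using full_cycles_conj[of _ S u v] by (auto simp: fun_eq_iff)
  have "bij_betw ?h (?Y S p) (?Y (?t ` S) (?c p))"
  proof (rule bij_betw_byWitness[where f' = ?h])
    show "\<forall>ab\<in>?Y S p. ?h (?h ab) = ab" "\<forall>ab\<in>?Y (?t ` S) (?c p). ?h (?h ab) = ab"
      using hh by blast+
    show "?h ` ?Y S p \<subseteq> ?Y (?t ` S) (?c p)" by (rule sub)
    show "?h ` ?Y (?t ` S) (?c p) \<subseteq> ?Y S p"
      using sub[of "?t ` S" "?c p"] unfolding cc tt .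
  qed
  then show ?thesis by (simp add: num_fact_def bij_betw_same_card)
qed

text \<open>Both sides end in \<open>p \<circ> transpose g y\<close>, which leaves an identity
  between products of two transpositions on \<open>f\<close>, \<open>g\<close>, \<open>p f\<close>,
  \<open>p y\<close>. On the excluded path y -> f -> g, erasing \<open>f\<close> makes
  \<open>y\<close> point to \<open>g\<close>, and bypassing \<open>g\<close> makes \<open>f\<close>
  a fixed point, so both orders contribute 0 in \<open>num_fact1_rec\<close>.\<close>

lemma bypass_commute:
  assumes "inj p" "f \<noteq> g" "y \<noteq> f" "y \<noteq> g" "\<not> (p y = f \<and> p f = g)"
  shows "bypass g y (bypass f f p) = bypass f f (bypass g y p)"
proof -
  have ne: "p f \<noteq> p y" using assms by (simp add: inj_eq)
  have "transpose g (transpose f (p f) (p y)) \<circ> transpose f (p f)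
      = transpose f (transpose g (p y) (p f)) \<circ> transpose g (p y)"
    using assms ne by (auto simp: fun_eq_iff Transposition.transpose_def)
  then have "transpose g (transpose f (p f) (p y)) \<circ> transpose f (p f) \<circ> p \<circ> transpose g y
      = transpose f (transpose g (p y) (p f)) \<circ> transpose g (p y) \<circ> p \<circ> transpose g y" 
    by simp
  then show ?thesis using assms by (simp add: bypass_def comp_assoc)
qed

text \<open>For \<open>y\<close> different from \<open>f\<close> this matches the guards of
  \<open>A f y\<close> and \<open>B f y\<close> in \<open>num_fact1_rec\<close>.\<close>

lemma bypass_cond:
  assumes "inj p" "f \<noteq> g" "y \<noteq> f" "y \<noteq> g"
  shows "p f \<noteq> f \<and> bypass f f p y \<noteq> g \<longleftrightarrow> p y \<noteq> g \<and> bypass g y p f \<noteq> f"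
proof -
  have ne: "p f \<noteq> p y" using assms by (simp add: inj_eq)
  show ?thesis
    using assms ne by (auto simp: bypass_def Transposition.transpose_def)
qed

text \<open>Bypassing \<open>g\<close> along \<open>y\<close> lets \<open>y\<close> inherit the
  image \<open>p g\<close>. Erasing \<open>y\<close> then redirects the arrow into \<open>y\<close>
  to \<open>p g\<close>, which so takes the place that \<open>y\<close> has on the other side, where
  \<open>p g\<close> is the deleted point.\<close>

lemma bypass_twice_conj:
  assumes "inj p" "y \<noteq> g" "y \<noteq> p g" "p y \<noteq> g" "p g \<noteq> g"
  shows "bypass y y (bypass g y p) = 
    transpose (p g) y \<circ> bypass (p g) y (bypass g g p) \<circ> transpose (p g) y"
proof -
  define v w where vw: "v = p g" "w = p y"
  have ne: "w \<noteq> v" using assms by (simp add: inj_eq vw)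
  have 1: "bypass g y p y = v" using assms ne by (simp add: bypass_def vw)
  have 2: "bypass g g p y = w" using assms ne by (simp add: bypass_def vw)
  have "bypass y y (bypass g y p) = transpose y v \<circ> (transpose g w \<circ> (p \<circ> transpose g y))"
    by (simp add: bypass_same 1) (simp add: bypass_def vw comp_assoc)
  also have "p \<circ> transpose g y = transpose v w \<circ> p"
    using comp_transpose[OF assms(1)] by (simp add: vw)
  also have "transpose g w \<circ> (transpose v w \<circ> p) = transpose v w \<circ> (transpose g v \<circ> p)"
  proof -
    have "transpose g w \<circ> transpose v w = transpose v w \<circ> transpose g v"
      using assms ne by (auto simp: fun_eq_iff Transposition.transpose_def vw)
    then show ?thesis by (metis comp_assoc)
  qed
  also have "transpose y v \<circ> (transpose v w \<circ> (transpose g v \<circ> p))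
      = transpose v y \<circ> bypass v y (bypass g g p) \<circ> transpose v y"
  proof -
    have "bypass v y (bypass g g p) \<circ> transpose v y = transpose v w \<circ> (transpose g v \<circ> p)"
      unfolding bypass_def[of v y] 2 comp_assoc transpose_comp_involutory comp_id
      by (simp add: bypass_same vw)
    then show ?thesis by (simp add: comp_assoc transpose_commute)
  qed
  finally show ?thesis by (simp add: vw)
qed

text \<open>Both sides become double sums after one application of \<open>num_fact_rec\<close> on the left.  The terms
  \<open>f \<noteq> y\<close> agree since the two deletions commute.  The term \<open>f = g\<close> on the left equals the sum of
  the diagonal terms \<open>f = y\<close> on the right, by \<open>num_fact_rec\<close> at the point \<open>p g\<close> and conjugation.\<close>
lemma num_fact1_rec:
  assumes fin: "finite S" and p: "p permutes S" and g: "g \<in> S" "p g \<noteq> g" and card: "card S \<ge> 3"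
  shows "num_fact1 S p = (\<Sum>y | y \<in> S - {g} \<and> p y \<noteq> g. num_fact1 (S - {g}) (bypass g y p))"
proof -
  define T where "T = S - {g}"
  have T: "finite T" "\<And>f. f \<in> T \<longleftrightarrow> f \<in> S \<and> f \<noteq> g" using fin by (auto simp: T_def)
  have inj: "inj p" using p by (rule permutes_inj)
  \<comment> \<open>The recursion \<open>num_fact_rec\<close> is applied on \<open>S - {f}\<close>
    at \<open>g\<close> and on \<open>T\<close> at \<open>p g\<close>; three points keep both sets
    from being singletons.\<close>
  have ne: "S - {f} - {g} \<noteq> {}" "T - {f} \<noteq> {}" for f
  proof -
    have "\<not> S \<subseteq> {g, f}"
    proof
      assume "S \<subseteq> {g, f}"
      then have "card S \<le> card {g, f}" by (intro card_mono) auto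
      then show False using card by (cases "g = f") simp_all
    qed
    then show "S - {f} - {g} \<noteq> {}" "T - {f} \<noteq> {}" by (auto simp: T_def)
  qed
  \<comment> \<open>\<open>A\<close> erases \<open>f\<close> before \<open>g\<close> is bypassed, so
    \<open>y = f\<close> is no longer available; \<open>B\<close> takes the opposite order and keeps
    \<open>y = f\<close>. The default 0 lets both range over all of
    \<open>T \<times> T\<close>.\<close>
  define A where "A f y = (if p f \<noteq> f \<and> y \<noteq> f \<and> bypass f f p y \<noteq> g
    then num_fact (T - {f}) (bypass g y (bypass f f p)) else 0)" for f y
  define B where "B f y = (if p y \<noteq> g \<and> bypass g y p f \<noteq> f
    then num_fact (T - {f}) (bypass f f (bypass g y p)) else 0)" for f y
  let ?v = "p g"
  have v: "?v \<in> T" using g p T by (simp add: permutes_in_image)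

  have "num_fact1 S p = (\<Sum>f\<in>S. if p f \<noteq> f then num_fact (S - {f}) (bypass f f p) else 0)"
    using fin by (simp add: num_fact1_def sum.inter_filter)
  also have "S = insert g T" using g by (auto simp: T_def)
  also have "(\<Sum>f\<in>insert g T. if p f \<noteq> f then num_fact (insert g T - {f}) (bypass f f p) else 0)
    = num_fact T (bypass g g p) + (\<Sum>f\<in>T. if p f \<noteq> f then num_fact (insert g T - {f}) (bypass f f p) else 0)"
    using g T by (subst sum.insert) (auto simp: T_def)
  also have "insert g T = S" using g by (auto simp: T_def)
  also have "(\<Sum>f\<in>T. if p f \<noteq> f then num_fact (S - {f}) (bypass f f p) else 0) = (\<Sum>f\<in>T. \<Sum>y\<in>T. A f y)"
  proof (rule sum.cong[OF refl])
    fix f assume f: "f \<in> T"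
    show "(if p f \<noteq> f then num_fact (S - {f}) (bypass f f p) else 0) = (\<Sum>y\<in>T. A f y)"
    proof (cases "p f = f")
      case True
      then show ?thesis by (simp add: A_def)
    next
      case False
      have "num_fact (S - {f}) (bypass f f p) =
        (\<Sum>y | y \<in> S - {f} - {g} \<and> bypass f f p y \<noteq> g. num_fact (S - {f} - {g}) (bypass g y (bypass f f p)))"
        using fin p f T g ne by (intro num_fact_rec bypass_permutes) auto
      also have "\<dots> = (\<Sum>y\<in>T. A f y)"
      proof -
        have "S - {f} - {g} = T - {f}" by (auto simp: T_def)
        moreover have "{y \<in> T - {f}. bypass f f p y \<noteq> g} = {y \<in> T. y \<noteq> f \<and> bypass f f p y \<noteq> g}" by auto
        ultimately show ?thesis using False by (simp only: A_def) (simp add: T(1) sum.inter_filter)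
      qed
      finally show ?thesis using False by simp
    qed
  qed
  also have "num_fact T (bypass g g p) = (\<Sum>y\<in>T. B y y)"
  proof -
    have "num_fact T (bypass g g p) = (\<Sum>y | y \<in> T - {?v} \<and> bypass g g p y \<noteq> ?v.
        num_fact (T - {?v}) (bypass ?v y (bypass g g p)))"
      using T p g v ne unfolding T_def by (intro num_fact_rec bypass_permutes) (auto simp: fin)
    also have "\<dots> = (\<Sum>y | y \<in> T - {?v} \<and> bypass g g p y \<noteq> ?v. B y y)"
    proof (rule sum.cong[OF refl])
      fix y assume "y \<in> {y. y \<in> T - {?v} \<and> bypass g g p y \<noteq> ?v}"
      then have y: "y \<in> T" "y \<noteq> ?v" "y \<noteq> g" and y2: "bypass g g p y \<noteq> ?v" by (auto simp: T)
      have py: "p y \<noteq> g" using y2 y by (auto simp: bypass_def)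
      have pyv: "p y \<noteq> ?v" using y inj by (simp add: inj_eq)
      have 1: "bypass g y p y = ?v" using y py g pyv by (simp add: bypass_def)
      have im: "transpose ?v y ` (T - {?v}) = T - {y}"
      proof -
        have "transpose ?v y ` (T - {?v}) = transpose ?v y ` T - {y}"
          using image_set_diff[OF inj_transpose[of ?v y], of T "{?v}"] by simp
        then show ?thesis using v y by simp
      qed
      have "num_fact (T - {y}) (bypass y y (bypass g y p)) = num_fact (T - {?v}) (bypass ?v y (bypass g g p))"
        unfolding bypass_twice_conj[OF inj y(3) y(2) py g(2)] im[symmetric] by (rule num_fact_conj)
      then show "num_fact (T - {?v}) (bypass ?v y (bypass g g p)) = B y y"
        using py 1 y(2) by (simp add: B_def)
    qed
    \<comment> \<open>The added diagonal terms vanish: either \<open>p y = g\<close>, or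
      \<open>y = p g\<close>, and then bypassing \<open>g\<close> leaves \<open>y\<close>
      fixed.\<close>
    also have "\<dots> = (\<Sum>y\<in>T. B y y)"
    proof (intro sum.mono_neutral_left ballI)
      fix y assume y: "y \<in> T - {y. y \<in> T - {?v} \<and> bypass g g p y \<noteq> ?v}"
      show "B y y = 0"
      proof (cases "p y = g")
        case False
        have "y \<noteq> g" "p y \<noteq> ?v" using y T inj by (auto simp: inj_eq)
        then have "bypass g g p y = p y" "bypass g y p y = ?v" 
          using False g by (simp_all add: bypass_def)
        then show ?thesis using y \<open>p y \<noteq> ?v\<close> by (auto simp: B_def)
      qed (simp add: B_def)
    qed (use T in auto)
    finally show ?thesis .
  qed
  also have "(\<Sum>y\<in>T. B y y) + (\<Sum>f\<in>T. \<Sum>y\<in>T. A f y) = (\<Sum>f\<in>T. \<Sum>y\<in>T. B f y)"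
  proof -
    have "B f f + (\<Sum>y\<in>T. A f y) = (\<Sum>y\<in>T. B f y)" if f: "f \<in> T" for f
    proof -
      have "A f y = B f y" if "y \<in> T - {f}" for y
      proof -
        have "f \<noteq> g" "y \<noteq> f" "y \<noteq> g" using that f T by auto
        note * = bypass_cond[OF inj this] bypass_commute[OF inj this]
        show ?thesis
        proof (cases "p y = f \<and> p f = g")
          case True
          then show ?thesis using *(1) \<open>y \<noteq> f\<close> \<open>f \<noteq> g\<close>
            by (auto simp: A_def B_def bypass_def)
        next
          case False
          then show ?thesis using * \<open>y \<noteq> f\<close> by (simp add: A_def B_def)
        qed
      qed
      then have "(\<Sum>y\<in>T - {f}. A f y) = (\<Sum>y\<in>T - {f}. B f y)" by (rule sum.cong[OF refl])
      moreover have "A f f = 0" by (simp add: A_def)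
      ultimately show ?thesis using f T(1) by (simp add: sum.remove[of T f])
    qed
    then show ?thesis by (simp add: sum.distrib[symmetric])
  qed
  also have "\<dots> = (\<Sum>y\<in>T. \<Sum>f\<in>T. B f y)" by (rule sum.swap)
  also have "\<dots> = (\<Sum>y\<in>T. if p y \<noteq> g then num_fact1 T (bypass g y p) else 0)"
    using T(1) by (intro sum.cong[OF refl]) (simp add: B_def num_fact1_def sum.inter_filter)
  also have "\<dots> = (\<Sum>y | y \<in> T \<and> p y \<noteq> g. num_fact1 T (bypass g y p))"
    using T(1) by (simp add: sum.inter_filter)
  finally show ?thesis by (simp only: T_def)
qed

lemma num_fact_singleton: "num_fact {x} id = 1"
proof -
  have "{(a, b). a \<in> full_cycles {x} \<and> b \<in> full_cycles {x} \<and> a \<circ> b = id} = {(id, id)}"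
    unfolding full_cycles_singleton by auto
  then show ?thesis by (simp add: num_fact_def)
qed

text \<open>Two proper transpositions cancel in the sign, so oddness is inherited along the
  recursion.\<close>

lemma sign_bypass:
  assumes "permutation p" "y \<noteq> f" "p y \<noteq> f"
  shows "sign (bypass f y p) = sign p"
  using assms
  by (auto simp: bypass_def sign_compose permutation_compose permutation_swap_id sign_swap_id)

text \<open>An odd permutation moves some \<open>g\<close>. In the recursion at \<open>g\<close>
  only \<open>y = g\<close> and \<open>y = inv p g\<close> drop out, two different points, so
  \<open>card S - 2\<close> equal terms remain.\<close>

lemma num_fact1_odd:
  assumes "finite S" "p permutes S" "sign p = -1"
  shows "num_fact1 S p = 2 * fact (card S - 2)"
  using assms
proof (induction "card S" arbitrary: S p rule: less_induct)
  case (less S p)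
  note fin = \<open>finite S\<close> and p = \<open>p permutes S\<close> and odd = \<open>sign p = -1\<close>
  have "p \<noteq> id" using odd by auto
  then obtain g where g: "p g \<noteq> g" by (auto simp: fun_eq_iff)
  then have gS: "g \<in> S" using p by (metis permutes_not_in)
  have pg: "p g \<in> S" using permutes_in_image[OF p] gS by simp
  have "card {g, p g} \<le> card S" using gS pg fin by (intro card_mono) auto
  then have c2: "card S \<ge> 2" using g by simp
  show ?case
  proof (cases "card S = 2")
    \<comment> \<open>On two points \<open>p\<close> is the transposition. Either point may be the
      erased one, with one factorisation each: this is the constant 2.\<close>
    case True
    have S: "S = {g, p g}"
      using card_subset_eq[OF fin, of "{g, p g}"] True gS pg g by auto
    define h where "h = p g"
    have gh: "g \<noteq> h" using g by (simp add: h_def)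
    have "p = transpose g h" 
      using p S \<open>p \<noteq> id\<close> permutes_doubleton_iff[of p g h] by (simp add: h_def)
    moreover have "{f \<in> {g, h}. transpose g h f \<noteq> f} = {g, h}" using gh by auto
    moreover have "{g, h} - {g} = {h}" "{g, h} - {h} = {g}" using gh by auto
    ultimately show ?thesis
      using True gh unfolding num_fact1_def S h_def[symmetric]
      by (simp add: bypass_same num_fact_singleton transpose_commute[of g h])
  next
    case False
    then have c3: "card S \<ge> 3" using c2 by simp
    have "num_fact1 S p = (\<Sum>y | y \<in> S - {g} \<and> p y \<noteq> g. num_fact1 (S - {g}) (bypass g y p))"
      using fin p gS g c3 by (rule num_fact1_rec)
    also have "\<dots> = (\<Sum>y | y \<in> S - {g} \<and> p y \<noteq> g. 2 * fact (card S - 3))"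
    proof (rule sum.cong[OF refl])
      fix y assume y: "y \<in> {y. y \<in> S - {g} \<and> p y \<noteq> g}"
      have cS: "card (S - {g}) = card S - 1" using gS fin by simp
      have "num_fact1 (S - {g}) (bypass g y p) = 2 * fact (card (S - {g}) - 2)"
      proof (rule less.hyps)
        show "card (S - {g}) < card S" using cS c2 by simp
        show "finite (S - {g})" using fin by simp
        show "bypass g y p permutes S - {g}" using p gS y by (intro bypass_permutes) auto
        show "sign (bypass g y p) = -1"
          using sign_bypass[OF permutes_imp_permutation[OF fin p]] y odd by simp
      qed
      then show "num_fact1 (S - {g}) (bypass g y p) = 2 * fact (card S - 3)"
        unfolding cS using c3 by (simp add: numeral_3_eq_3)
    qed
    also have "\<dots> = card {y. y \<in> S - {g} \<and> p y \<noteq> g} * (2 * fact (card S - 3))" by simp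
    also have "{y. y \<in> S - {g} \<and> p y \<noteq> g} = S - {g, inv p g}"
    proof -
      have "y = inv p g \<longleftrightarrow> p y = g" for y using permutes_inv_eq[OF p, of g y] by auto
      then show ?thesis by auto
    qed
    also have "card \<dots> = card S - 2"
    proof -
      have "inv p g \<noteq> g" "inv p g \<in> S"
        using g gS p by (auto simp: permutes_inv_eq permutes_in_image[OF permutes_inv])
      then show ?thesis using gS fin by (subst card_Diff_subset) auto
    qed
    also have "(card S - 2) * (2 * fact (card S - 3)) = 2 * (fact (card S - 2) :: nat)"
    proof -
      obtain k where "card S = k + 3" using c3 le_Suc_ex by (metis add.commute)
      then show ?thesis by simp
    qed
    finally show ?thesis .
  qed
qed

section \<open>Signs and cycle numbers summed over the symmetric group\<close>

text \<open>A new fixed point raises both summands of the exponent; a proper insertion raises only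
  the cardinality and flips the sign.\<close>

lemma sign_eq_num_cycles:
  assumes "finite S" "p permutes S"
  shows "sign p = (-1) ^ (card S + num_cycles S p)"
  using assms
proof (induction arbitrary: p rule: finite_induct)
  case empty
  then show ?case by (simp add: num_cycles_def)
next
  case (insert f S)
  have "p \<in> {p. p permutes insert f S}" using insert by simp
  then obtain x q where x: "x \<in> insert f S" and q: "q permutes S" and p: "p = transpose f x \<circ> q"
    unfolding permutes_insert by auto
  have "sign p = (if x = f then 1 else -1) * sign q"
    unfolding p using permutes_imp_permutation[OF insert.hyps(1) q]
    by (auto simp: sign_compose permutation_swap_id sign_swap_id)
  also have "sign q = (-1) ^ (card S + num_cycles S q)" using insert.IH q by simp
  finally have "sign p = (if x = f then 1 else -1) * (-1) ^ (card S + num_cycles S q)" .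
  moreover have "num_cycles (insert f S) p = (if x = f then Suc (num_cycles S q) else num_cycles S q)"
    unfolding p using x num_cycles_insert_fixed[OF insert.hyps(1) q insert.hyps(2)]
      num_cycles_transpose_insert[OF insert.hyps(1) q insert.hyps(2)] by auto
  ultimately show ?case using insert.hyps by simp
qed

lemma sum_sign_permutes:
  assumes "finite S" "card S \<ge> 2"
  shows "(\<Sum>p | p permutes S. sign p) = 0"
proof -
  obtain a b where ab: "a \<in> S" "b \<in> S" "a \<noteq> b"
    using assms by (metis card_2_iff' obtain_subset_with_card_n subsetD)
  let ?t = "transpose a b"
  have "(\<Sum>p | p permutes S. sign p) = (\<Sum>p | p permutes S. sign (?t \<circ> p))"
    using ab by (intro setum_permutations_compose_left permutes_swap_id)
  also have "\<dots> = (\<Sum>p | p permutes S. - sign p)"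
    using ab permutes_imp_permutation[OF assms(1)]
    by (intro sum.cong refl) (simp add: sign_compose permutation_swap_id sign_swap_id)
  finally show ?thesis by (simp add: sum_negf)
qed

text \<open>A new point is either fixed, giving one more cycle, or inserted before an old point,
  giving none. So the mean grows by 1/(n + 1) from n to n + 1 points.\<close>

lemma sum_num_cycles:
  assumes "finite S"
  shows "(\<Sum>p | p permutes S. real (num_cycles S p)) = fact (card S) * harm (card S)"
  using assms
proof (induction rule: finite_induct)
  case empty
  then show ?case by (simp add: num_cycles_def harm_def)
next
  case (insert f S)
  have "(\<Sum>p | p permutes insert f S. real (num_cycles (insert f S) p))
    = (\<Sum>x\<in>insert f S. \<Sum>q | q permutes S. real (num_cycles (insert f S) (transpose f x \<circ> q)))"
    using insert.hyps by (rule sum_over_permutations_insert)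
  also have "\<dots> = (\<Sum>q | q permutes S. 1 + real (num_cycles S q))
    + (\<Sum>x\<in>S. \<Sum>q | q permutes S. real (num_cycles S q))"
    unfolding sum.insert[OF insert.hyps] using insert.hyps
    by (intro arg_cong2[where f = "(+)"] sum.cong)
      (auto simp: num_cycles_insert_fixed num_cycles_transpose_insert)
  also have "\<dots> = fact (card S) + (1 + real (card S)) * (fact (card S) * harm (card S))"
    using insert by (simp add: sum.distrib card_permutations algebra_simps)
  also have "\<dots> = fact (card (insert f S)) * harm (card (insert f S))"
    using insert.hyps by (simp add: harm_Suc field_simps)
  finally show ?case .
qed

text \<open>The same insertion, but each proper one reverses the sign, which gives the factor 1 - n
  from n to n + 1 points.\<close>

lemma sum_sign_num_cycles:
  assumes "finite S" "card S \<ge> 2"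
  shows "(\<Sum>p | p permutes S. real_of_int (sign p) * real (num_cycles S p)) = (-1) ^ card S * fact (card S - 2)"
proof -
  have step: "(\<Sum>p | p permutes insert f S. real_of_int (sign p) * real (num_cycles (insert f S) p))
    = real_of_int (\<Sum>p | p permutes S. sign p) + 
      (1 - real (card S)) * (\<Sum>p | p permutes S. real_of_int (sign p) * real (num_cycles S p))"
    if S: "finite S" "f \<notin> S" for f :: 'a and S
  proof -
    have "(\<Sum>p | p permutes insert f S. real_of_int (sign p) * real (num_cycles (insert f S) p))
      = (\<Sum>x\<in>insert f S. \<Sum>q | q permutes S. 
          real_of_int (sign (transpose f x \<circ> q)) * real (num_cycles (insert f S) (transpose f x \<circ> q)))"
      using S by (rule sum_over_permutations_insert)
    also have "\<dots> = (\<Sum>q | q permutes S. real_of_int (sign q) * (1 + real (num_cycles S q)))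
      + (\<Sum>x\<in>S. \<Sum>q | q permutes S. - (real_of_int (sign q) * real (num_cycles S q)))"
    proof -
      have "real_of_int (sign (transpose f x \<circ> q)) * real (num_cycles (insert f S) (transpose f x \<circ> q))
        = - (real_of_int (sign q) * real (num_cycles S q))" if "x \<in> S" "q permutes S" for x q
      proof -
        have "sign (transpose f x \<circ> q) = - sign q"
          using that S permutes_imp_permutation[OF S(1)]
          by (auto simp: sign_compose permutation_swap_id sign_swap_id)
        then show ?thesis using num_cycles_transpose_insert[OF S(1) that(2) S(2) that(1)] by simp
      qed
      then show ?thesis
        unfolding sum.insert[OF S] using S
        by (intro arg_cong2[where f = "(+)"] sum.cong) (auto simp: num_cycles_insert_fixed)
    qed
    finally show ?thesis by (simp add: sum.distrib sum_negf algebra_simps)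
  qed
  show ?thesis
    using assms
  proof (induction rule: finite_induct)
    case (insert f S)
    show ?case
    \<comment> \<open>Only on a single point is the sum of signs nonzero; it supplies the initial
      value 1 at two points.\<close>
    proof (cases "card S = 1")
      case True
      then obtain x where x: "S = {x}" by (auto simp: card_1_singleton_iff)
      have "{p. p permutes S} = {id}" unfolding x by (auto simp: permutes_sing)
      moreover have "num_cycles S id = 1" unfolding x by (simp add: num_cycles_def)
      ultimately show ?thesis using step[OF insert.hyps] insert.hyps True by simp
    next
      case False
      then have c: "card S \<ge> 2" using insert by simp
      then obtain k where k: "card S = k + 2" using le_Suc_ex by (metis add.commute)
      show ?thesis using step[OF insert.hyps] insert.hyps insert.IH[OF c] k 
        sum_sign_permutes[OF insert.hyps(1) c] by (simp add: algebra_simps)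
    qed
  qed simp
qed

text \<open>Full cycles on the same set have equal signs, so their product is even.\<close>

lemma num_fact_odd:
  assumes "finite S" "sign p \<noteq> 1"
  shows "num_fact S p = 0"
proof -
  have False if ab: "a \<in> full_cycles S" "b \<in> full_cycles S" "a \<circ> b = p" for a b
  proof -
    have pm: "a permutes S" "b permutes S" using ab by (auto simp: full_cycles_def)
    moreover have "num_cycles S a = 1" "num_cycles S b = 1"
      using ab pm assms(1) cyclic_on_iff_num_cycles by (auto simp: full_cycles_def)
    ultimately have "sign a = sign b" using sign_eq_num_cycles assms(1) by metis
    then have "sign p = 1"
      using ab(3) sign_compose permutes_imp_permutation[OF assms(1)] pm sign_idempotent by metis
    then show False using assms(2) by simp
  qed
  then have "{(a, b). a \<in> full_cycles S \<and> b \<in> full_cycles S \<and> a \<circ> b = p} = {}" by blast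
  then show ?thesis by (simp only: num_fact_def card.empty)
qed

section \<open>The number of cycles of a product of two full cycles\<close>

text \<open>For \<open>S = {..<n}\<close> this is the total number of faces over all rotation
  systems of the dipole.\<close>

definition cycle_total :: "'a set \<Rightarrow> nat" where
  "cycle_total S = (\<Sum>(a, b)\<in>full_cycles S \<times> full_cycles S. num_cycles S (a \<circ> b))"

lemma cycle_total_altdef:
  assumes "finite S"
  shows "cycle_total S = (\<Sum>p | p permutes S. num_fact S p * num_cycles S p)"
proof -
  let ?F = "full_cycles S \<times> full_cycles S"
  have "cycle_total S = (\<Sum>p | p permutes S. \<Sum>ab | ab \<in> ?F \<and> (case ab of (a, b) \<Rightarrow> a \<circ> b) = p.
      case ab of (a, b) \<Rightarrow> num_cycles S (a \<circ> b))"
    unfolding cycle_total_def using assms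
    by (intro sum.group[symmetric])
      (auto simp: finite_full_cycles finite_permutations full_cycles_def intro: permutes_compose)
  also have "\<dots> = (\<Sum>p | p permutes S. num_fact S p * num_cycles S p)"
  proof (rule sum.cong[OF refl])
    fix p assume "p \<in> {p. p permutes S}"
    let ?X = "{ab. ab \<in> ?F \<and> (case ab of (a, b) \<Rightarrow> a \<circ> b) = p}"
    have "(\<Sum>ab\<in>?X. case ab of (a, b) \<Rightarrow> num_cycles S (a \<circ> b)) = (\<Sum>ab\<in>?X. num_cycles S p)"
      by (rule sum.cong[OF refl]) auto
    moreover have "?X = {(a, b). a \<in> full_cycles S \<and> b \<in> full_cycles S \<and> a \<circ> b = p}" by auto
    ultimately show "(\<Sum>ab\<in>?X. case ab of (a, b) \<Rightarrow> num_cycles S (a \<circ> b)) = num_fact S p * num_cycles S p"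
      by (simp only: num_fact_def sum_constant of_nat_id)
  qed
  finally show ?thesis .
qed

lemma num_cycles_conj:
  assumes "finite S" "p permutes S"
  shows "num_cycles (transpose u v ` S) (transpose u v \<circ> p \<circ> transpose u v) = num_cycles S p"
proof -
  let ?t = "transpose u v"
  have "orbit (?t \<circ> p \<circ> ?t) (?t x) = ?t ` orbit p x" for x
    by (rule orbit_inverse[symmetric])
      (simp_all add: permutation_self_in_orbit permutes_imp_permutation[OF assms])
  then have "orbit (?t \<circ> p \<circ> ?t) ` ?t ` S = (\<lambda>X. ?t ` X) ` orbit p ` S"
    unfolding image_image by (intro image_cong) simp_all
  moreover have "inj_on (\<lambda>X. ?t ` X) (orbit p ` S)"
    by (rule inj_onI) (metis inj_image_eq_iff inj_transpose)
  ultimately show ?thesis by (simp add: num_cycles_def card_image)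
qed

lemma bij_betw_full_cycles_conj:
  "bij_betw (\<lambda>a. transpose u v \<circ> a \<circ> transpose u v) (full_cycles S) (full_cycles (transpose u v ` S))"
proof (rule bij_betw_byWitness[where f' = "\<lambda>a. transpose u v \<circ> a \<circ> transpose u v"])
  let ?c = "\<lambda>a. transpose u v \<circ> a \<circ> transpose u v"
  show "\<forall>a\<in>full_cycles S. ?c (?c a) = a" "\<forall>a\<in>full_cycles (transpose u v ` S). ?c (?c a) = a"
    by (simp_all add: fun_eq_iff)
  show "?c ` full_cycles S \<subseteq> full_cycles (transpose u v ` S)"
    by (intro image_subsetI full_cycles_conj)
  show "?c ` full_cycles (transpose u v ` S) \<subseteq> full_cycles S"
    using full_cycles_conj[of _ "transpose u v ` S" u v]
    by (intro image_subsetI) (simp add: image_comp)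
qed

lemma cycle_total_conj:
  assumes "finite S"
  shows "cycle_total (transpose u v ` S) = cycle_total S"
proof -
  let ?t = "transpose u v"
  let ?c = "\<lambda>a. ?t \<circ> a \<circ> ?t"
  have "cycle_total (?t ` S) = (\<Sum>ab\<in>full_cycles S \<times> full_cycles S.
      case map_prod ?c ?c ab of (a, b) \<Rightarrow> num_cycles (?t ` S) (a \<circ> b))"
    unfolding cycle_total_def
    by (rule sum.reindex_bij_betw[symmetric]) (intro bij_betw_map_prod bij_betw_full_cycles_conj)
  also have "\<dots> = cycle_total S"
    unfolding cycle_total_def
  proof (rule sum.cong[OF refl])
    fix ab assume ab: "ab \<in> full_cycles S \<times> full_cycles S"
    obtain a b where ab': "ab = (a, b)" by (cases ab)
    have "a \<circ> b permutes S" using ab ab' by (auto simp: full_cycles_def intro: permutes_compose)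
    moreover have "?c a \<circ> ?c b = ?c (a \<circ> b)" by (simp add: fun_eq_iff)
    ultimately show "(case map_prod ?c ?c ab of (a, b) \<Rightarrow> num_cycles (?t ` S) (a \<circ> b)) 
        = (case ab of (a, b) \<Rightarrow> num_cycles S (a \<circ> b))"
      using num_cycles_conj[OF assms, of "a \<circ> b" u v] unfolding ab' prod.case map_prod_simp by simp
  qed
  finally show ?thesis .
qed

text \<open>The factorisations counted by \<open>num_fact1\<close> erase varying points; this makes
  their contributions equal.\<close>

lemma cycle_total_Diff:
  assumes "finite S" "f \<in> S" "g \<in> S"
  shows "cycle_total (S - {f}) = cycle_total (S - {g})"
proof -
  have "transpose f g ` (S - {g}) = S - {f}"
    using image_set_diff[OF inj_transpose[of f g], of S "{g}"] assms by simp
  then show ?thesis using cycle_total_conj[of "S - {g}" f g] assms by simp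
qed

lemma sum_odd_num_cycles:
  assumes "finite S" "card S \<ge> 2"
  shows "(\<Sum>p | p permutes S \<and> sign p = -1. real (num_cycles S p))
    = (fact (card S) * harm (card S) - (-1) ^ card S * fact (card S - 2)) / 2"
proof -
  let ?P = "{p. p permutes S}"
  have "(\<Sum>p | p permutes S \<and> sign p = -1. real (num_cycles S p)) 
      = (\<Sum>p\<in>?P. if sign p = -1 then real (num_cycles S p) else 0)"
    using finite_permutations[OF assms(1)] by (simp add: sum.inter_filter[symmetric])
  \<comment> \<open>The indicator of odd permutations is (1 - sign) / 2.\<close>
  also have "\<dots> = (\<Sum>p\<in>?P. (real (num_cycles S p) - real_of_int (sign p) * real (num_cycles S p)) / 2)"
    by (rule sum.cong[OF refl]) (auto intro: sign_cases)
  also have "\<dots> = ((\<Sum>p\<in>?P. real (num_cycles S p)) - (\<Sum>p\<in>?P. real_of_int (sign p) * real (num_cycles S p))) / 2"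
    by (simp only: sum_subtractf sum_divide_distrib[symmetric])
  finally show ?thesis by (simp add: sum_num_cycles sum_sign_num_cycles assms)
qed

text \<open>Erasing a point that is not fixed does not change the number of cycles.\<close>
lemma sum_num_fact1_num_cycles:
  assumes fin: "finite S"
  shows "(\<Sum>p | p permutes S \<and> sign p = -1. num_fact1 S p * num_cycles S p)
    = (\<Sum>f\<in>S. (card S - 1) * cycle_total (S - {f}))"
proof -
  let ?O = "{p. p permutes S \<and> sign p = -1}"
  have finO: "finite ?O" using finite_permutations[OF fin] by simp
  have "(\<Sum>p\<in>?O. num_fact1 S p * num_cycles S p) = (\<Sum>p\<in>?O. \<Sum>f\<in>S. 
      if p f \<noteq> f then num_fact (S - {f}) (bypass f f p) * num_cycles S p else 0)"
  proof (rule sum.cong[OF refl])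
    fix p
    have "num_fact1 S p * num_cycles S p
      = (\<Sum>f | f \<in> S \<and> p f \<noteq> f. num_fact (S - {f}) (bypass f f p) * num_cycles S p)"
      by (simp only: num_fact1_def sum_distrib_right)
    then show "num_fact1 S p * num_cycles S p = (\<Sum>f\<in>S. 
      if p f \<noteq> f then num_fact (S - {f}) (bypass f f p) * num_cycles S p else 0)"
      using fin by (simp only: sum.inter_filter)
  qed
  also have "\<dots> = (\<Sum>f\<in>S. \<Sum>p\<in>?O. if p f \<noteq> f then num_fact (S - {f}) (bypass f f p) * num_cycles S p else 0)"
    by (rule sum.swap)
  also have "\<dots> = (\<Sum>f\<in>S. (card S - 1) * cycle_total (S - {f}))"
  proof (rule sum.cong[OF refl])
    fix f assume f: "f \<in> S"
    define T where "T = S - {f}"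
    have T: "insert f T = S" "f \<notin> T" "finite T" "card T = card S - 1" using f fin by (auto simp: T_def)
    let ?G = "\<lambda>p. num_fact T (bypass f f p) * num_cycles S p"
    have sgn: "sign (bypass f f p) = - sign p" if "p permutes S" "p f \<noteq> f" for p
      using that permutes_imp_permutation[OF fin]
      by (auto simp: bypass_same sign_compose permutation_swap_id sign_swap_id)
    have "(\<Sum>p\<in>?O. if p f \<noteq> f then ?G p else 0) = (\<Sum>p | p \<in> ?O \<and> p f \<noteq> f. ?G p)"
      using finO by (simp only: sum.inter_filter)
    also have "\<dots> = (\<Sum>p | p permutes S \<and> p f \<noteq> f. ?G p)"
    proof (rule sum.mono_neutral_left)
      show "finite {p. p permutes S \<and> p f \<noteq> f}" using finite_permutations[OF fin] by simp
      show "\<forall>p\<in>{p. p permutes S \<and> p f \<noteq> f} - {p \<in> ?O. p f \<noteq> f}. ?G p = 0"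
      proof
        fix p assume p: "p \<in> {p. p permutes S \<and> p f \<noteq> f} - {p \<in> ?O. p f \<noteq> f}"
        then have "sign p = 1" by (cases p rule: sign_cases) auto
        then have "sign (bypass f f p) = -1" using sgn p by auto
        then show "?G p = 0" using num_fact_odd[OF T(3)] by simp
      qed
    qed auto
    \<comment> \<open>Erasing \<open>f\<close> from \<open>transpose f x \<circ> q\<close> returns
      \<open>q\<close> whatever \<open>x\<close> is, so each \<open>q\<close> is counted
      \<open>card T\<close> times.\<close>
    also have "\<dots> = (\<Sum>xq\<in>T \<times> {q. q permutes T}. ?G ((\<lambda>(x, q). transpose f x \<circ> q) xq))"
      using bij_betw_transpose_insert[OF T(2)] unfolding T(1)
      by (rule sum.reindex_bij_betw[symmetric])
    also have "\<dots> = (\<Sum>xq\<in>T \<times> {q. q permutes T}. num_fact T (snd xq) * num_cycles T (snd xq))"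
    proof (rule sum.cong[OF refl])
      fix xq assume xq: "xq \<in> T \<times> {q. q permutes T}"
      obtain x q where [simp]: "xq = (x, q)" by (cases xq)
      have xq': "x \<in> T" "q permutes T" using xq by auto
      then have "q f = f" using T by (simp add: permutes_not_in)
      then have "bypass f f (transpose f x \<circ> q) = q" by (simp add: bypass_same fun_eq_iff)
      then show "?G ((\<lambda>(x, q). transpose f x \<circ> q) xq) = num_fact T (snd xq) * num_cycles T (snd xq)"
        using num_cycles_transpose_insert[OF T(3) xq'(2) T(2) xq'(1)] T(1) by simp
    qed
    also have "\<dots> = (\<Sum>x\<in>T. \<Sum>q | q permutes T. num_fact T q * num_cycles T q)"
      unfolding sum.cartesian_product by (rule sum.cong[OF refl]) auto
    also have "\<dots> = (card S - 1) * cycle_total T"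
      using T by (simp add: cycle_total_altdef)
    finally show "(\<Sum>p\<in>?O. if p f \<noteq> f then num_fact (S - {f}) (bypass f f p) * num_cycles S p else 0)
      = (card S - 1) * cycle_total (S - {f})" by (simp only: T_def)
  qed
  finally show ?thesis .
qed

text \<open>With \<open>f\<close> as the appended point and n = \<open>card S\<close>, the sum of
  \<open>num_fact1 T p * num_cycles T p\<close> over odd \<open>p\<close> is evaluated twice. By
  erased points it is (n + 1) * n copies of \<open>cycle_total S\<close>; by uniformity it is 2 * (n
  - 1)! times the cycle count of all odd permutations.\<close>

lemma cycle_total_eq:
  assumes "finite S" "f \<notin> S" "S \<noteq> {}"
  shows "real (cycle_total S) = fact (card S - 1) ^ 2 *
    (harm (card S + 1) + (-1) ^ card S / (real (card S) * real (card S + 1)))"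
proof -
  define n where "n = card S"
  define T where "T = insert f S"
  have n: "n > 0" using assms by (simp add: n_def card_gt_0_iff)
  have T: "finite T" "card T = n + 1" "f \<in> T" "T - {f} = S" using assms by (auto simp: T_def n_def)
  have "(\<Sum>p | p permutes T \<and> sign p = -1. num_fact1 T p * num_cycles T p)
    = (\<Sum>g\<in>T. n * cycle_total (T - {g}))"
    using sum_num_fact1_num_cycles[OF T(1)] T(2) by simp
  also have "\<dots> = (\<Sum>g\<in>T. n * cycle_total S)"
    using cycle_total_Diff[OF T(1) _ T(3)] T(4) by (intro sum.cong[OF refl]) simp
  also have "\<dots> = (n + 1) * n * cycle_total S" using T(2) by (simp add: algebra_simps)
  finally have 1: "(n + 1) * n * cycle_total S = 
      (\<Sum>p | p permutes T \<and> sign p = -1. num_fact1 T p * num_cycles T p)" by simp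
  also have "\<dots> = (\<Sum>p | p permutes T \<and> sign p = -1. 2 * fact (n - 1) * num_cycles T p)"
    using num_fact1_odd[OF T(1)] T(2) by (intro sum.cong[OF refl]) simp
  finally have "real ((n + 1) * n * cycle_total S) = 
      2 * fact (n - 1) * (\<Sum>p | p permutes T \<and> sign p = -1. real (num_cycles T p))"
    by (simp add: sum_distrib_left)
  also have "\<dots> = fact (n - 1) * (fact (n + 1) * harm (n + 1) + (-1) ^ n * fact (n - 1))"
    using sum_odd_num_cycles[OF T(1)] n T(2) by simp
  also have "fact (n + 1) = (real n * real (n + 1)) * fact (n - 1)"
    using n by (cases n) simp_all
  also have "fact (n - 1) * (d * fact (n - 1) * h + e * fact (n - 1)) = d * (fact (n - 1) ^ 2 * (h + e / d))"
    if "d \<noteq> 0" for d e h :: real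
    using that by (simp add: field_simps power2_eq_square)
  finally have "real ((n + 1) * n * cycle_total S) = (real n * real (n + 1)) *
      (fact (n - 1) ^ 2 * (harm (n + 1) + (-1) ^ n / (real n * real (n + 1))))"
    using n by simp
  moreover have "real ((n + 1) * n * cycle_total S) = (real n * real (n + 1)) * real (cycle_total S)"
    by (simp only: of_nat_mult) simp
  moreover have "real n * real (n + 1) \<noteq> 0" using n by simp
  ultimately show ?thesis unfolding n_def[symmetric] by (metis mult_cancel_left)
qed

section \<open>Embeddings of the dipole\<close>

text \<open>The assumption on \<open>\<gamma>\<close> ensures that every rotation system is seen by
  some \<open>genus_count\<close>, so the value of the polynomial at 1 is the number of all rotation
  systems.\<close>

lemma average_genus_eq_mean:
  assumes fin: "finite (arcs G)"
    and \<gamma>: "\<And>\<rho>. \<rho> \<in> rotation_systems G \<Longrightarrow> euler_char G \<rho> = 2 - 2 * int (\<gamma> \<rho>)"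
  shows "average_genus G = (\<Sum>\<rho>\<in>rotation_systems G. real (\<gamma> \<rho>)) / real (card (rotation_systems G))"
proof -
  let ?R = "rotation_systems G" and ?K = "{k. genus_count G k \<noteq> 0}"
  have finR: "finite ?R"
    using fin by (intro finite_subset[OF _ finite_permutations[of "darts G"]])
      (auto simp: rotation_systems_def darts_def)
  have finK: "finite ?K" using fin by (rule finite_genus_count_support)
  have count: "genus_count G k = card {\<rho> \<in> ?R. \<gamma> \<rho> = k}" for k
    unfolding genus_count_def by (rule arg_cong[of _ _ card]) (use \<gamma> in auto)
  have sub: "\<gamma> ` ?R \<subseteq> ?K"
    using finR by (auto simp: count card_eq_0_iff)
  \<comment> \<open>Denominator and numerator are the cases of constant \<open>h\<close> and of
    \<open>h = real\<close>.\<close>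
  have group: "(\<Sum>k\<in>?K. h k * real (genus_count G k)) = (\<Sum>\<rho>\<in>?R. h (\<gamma> \<rho>))" for h :: "nat \<Rightarrow> real"
  proof -
    have "(\<Sum>\<rho>\<in>?R. h (\<gamma> \<rho>)) = (\<Sum>k\<in>?K. \<Sum>\<rho> | \<rho> \<in> ?R \<and> \<gamma> \<rho> = k. h (\<gamma> \<rho>))"
      using finR finK sub by (rule sum.group[symmetric])
    also have "\<dots> = (\<Sum>k\<in>?K. h k * real (genus_count G k))"
    proof (rule sum.cong[OF refl])
      fix k
      have "(\<Sum>\<rho> | \<rho> \<in> ?R \<and> \<gamma> \<rho> = k. h (\<gamma> \<rho>)) = (\<Sum>\<rho> | \<rho> \<in> ?R \<and> \<gamma> \<rho> = k. h k)"
        by (rule sum.cong[OF refl]) auto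
      then show "(\<Sum>\<rho> | \<rho> \<in> ?R \<and> \<gamma> \<rho> = k. h (\<gamma> \<rho>)) = h k * real (genus_count G k)"
        by (simp add: count)
    qed
    finally show ?thesis by simp
  qed
  have "poly (genus_poly G) 1 = (\<Sum>k\<in>?K. 1 * real (genus_count G k))"
    by (simp add: genus_poly_def poly_sum poly_monom)
  moreover have "poly (pderiv (genus_poly G)) 1 = (\<Sum>k\<in>?K. real k * real (genus_count G k))"
    by (simp add: genus_poly_def higher_pderiv_sum[of 1, simplified] pderiv_monom poly_sum poly_monom)
  ultimately show ?thesis
    using group[of "\<lambda>_. 1"] group[of real] by (simp add: average_genus_def)
qed

text \<open>The vertex of the dart \<open>(e, v)\<close> of the dipole is \<open>v\<close>, so \<open>a\<close> and \<open>b\<close> are the rotations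
  at the vertices \<open>False\<close> and \<open>True\<close>.\<close>
definition dipole_rotation :: "(nat \<Rightarrow> nat) \<Rightarrow> (nat \<Rightarrow> nat) \<Rightarrow> nat \<times> bool \<Rightarrow> nat \<times> bool" where
  "dipole_rotation a b d = (if snd d then b (fst d) else a (fst d), snd d)"

lemma darts_dipole: "darts (dipole n) = {..<n} \<times> UNIV"
  by (simp add: darts_def dipole_def)

lemma darts_at_dipole: "darts_at (dipole n) v = {..<n} \<times> {v}"
  unfolding darts_at_def darts_dipole by (auto simp: dart_vertex_def dipole_def)

lemma rotation_systems_dipole:
  assumes "n > 0"
  shows "rotation_systems (dipole n) =
    {\<rho>. \<rho> permutes {..<n} \<times> UNIV \<and> (\<forall>v. cyclic_on \<rho> ({..<n} \<times> {v}))}"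
  using assms unfolding rotation_systems_def darts_dipole darts_at_dipole
  by (auto simp: dipole_def)

lemma dipole_rotation_in_rotation_systems:
  assumes "n > 0" "a \<in> full_cycles {..<n}" "b \<in> full_cycles {..<n}"
  shows "dipole_rotation a b \<in> rotation_systems (dipole n)"
proof -
  have a: "a permutes {..<n}" "cyclic_on a {..<n}" and b: "b permutes {..<n}" "cyclic_on b {..<n}"
    using assms by (auto simp: full_cycles_def)
  have "dipole_rotation a b permutes {..<n} \<times> UNIV"
  proof (rule inj_imp_permutes)
    have inj: "a i = a j \<longleftrightarrow> i = j" "b i = b j \<longleftrightarrow> i = j" for i j
      using permutes_inj[OF a(1)] permutes_inj[OF b(1)] by (simp_all add: inj_eq)
    show "inj_on (dipole_rotation a b) ({..<n} \<times> UNIV)"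
      by (rule inj_onI) (auto simp: dipole_rotation_def inj prod_eq_iff split: if_splits)
    have less: "a i < n \<longleftrightarrow> i < n" "b i < n \<longleftrightarrow> i < n" for i
      using permutes_in_image[OF a(1), of i] permutes_in_image[OF b(1), of i] by simp_all
    show "dipole_rotation a b d \<in> {..<n} \<times> UNIV" if "d \<in> {..<n} \<times> UNIV" for d
      using that by (auto simp: dipole_rotation_def less)
    show "dipole_rotation a b d = d" if "d \<notin> {..<n} \<times> UNIV" for d
    proof -
      have "fst d \<notin> {..<n}" using that by (auto simp: mem_Times_iff)
      then have "a (fst d) = fst d" "b (fst d) = fst d"
        using permutes_not_in[OF a(1)] permutes_not_in[OF b(1)] by blast+
      then show ?thesis by (cases d) (simp add: dipole_rotation_def)
    qed
  qed simp
  moreover have "cyclic_on (dipole_rotation a b) ({..<n} \<times> {v})" for v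
  proof -
    have "cyclic_on (dipole_rotation a b) ((\<lambda>i. (i, v)) ` {..<n})"
    proof (cases v)
      case True
      then show ?thesis by (intro cyclic_on_image[OF b(2)]) (simp add: dipole_rotation_def)
    next
      case False
      then show ?thesis by (intro cyclic_on_image[OF a(2)]) (simp add: dipole_rotation_def)
    qed
    moreover have "(\<lambda>i. (i, v)) ` {..<n} = {..<n} \<times> {v}" by auto
    ultimately show ?thesis by simp
  qed
  ultimately show ?thesis using assms(1) by (simp add: rotation_systems_dipole)
qed

lemma rotation_system_dipole_component:
  assumes "n > 0" "\<rho> \<in> rotation_systems (dipole n)"
  shows "(\<lambda>i. fst (\<rho> (i, v))) \<in> full_cycles {..<n}" and "snd (\<rho> (i, v)) = v"
proof -
  have \<rho>: "\<rho> permutes {..<n} \<times> UNIV" "cyclic_on \<rho> ({..<n} \<times> {v})"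
    using assms by (auto simp: rotation_systems_dipole)
  have in_S: "\<rho> (i, v) \<in> {..<n} \<times> {v}" if "i < n" for i
    using cyclic_on_inI[OF \<rho>(2), of "(i, v)"] that by simp
  have out: "\<rho> (i, v) = (i, v)" if "\<not> i < n" for i
    using permutes_not_in[OF \<rho>(1), of "(i, v)"] that by simp
  show snd: "snd (\<rho> (i, v)) = v" for i
    using in_S[of i] out[of i] by (cases "i < n") auto
  let ?a = "\<lambda>i. fst (\<rho> (i, v))"
  have "?a permutes {..<n}"
  proof (rule inj_imp_permutes)
    show "inj_on ?a {..<n}"
    proof (rule inj_onI)
      fix i j assume "?a i = ?a j"
      then have "\<rho> (i, v) = \<rho> (j, v)" using snd[of i] snd[of j] by (simp add: prod_eq_iff)
      then show "i = j" using permutes_inj[OF \<rho>(1)] by (simp add: inj_eq)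
    qed
    show "?a i \<in> {..<n}" if "i \<in> {..<n}" for i using in_S[of i] that by auto
  qed (use out in auto)
  moreover have "cyclic_on ?a (fst ` ({..<n} \<times> {v}))"
    using \<rho>(2) by (rule cyclic_on_image) auto
  moreover have "fst ` ({..<n} \<times> {v}) = {..<n}" by auto
  ultimately show "?a \<in> full_cycles {..<n}" by (simp add: full_cycles_def)
qed

lemma bij_betw_dipole_rotation:
  assumes "n > 0"
  shows "bij_betw (\<lambda>(a, b). dipole_rotation a b) (full_cycles {..<n} \<times> full_cycles {..<n})
    (rotation_systems (dipole n))"
proof (rule bij_betw_byWitness
    [where f' = "\<lambda>\<rho>. (\<lambda>i. fst (\<rho> (i, False)), \<lambda>i. fst (\<rho> (i, True)))"])
  show "\<forall>\<rho>\<in>rotation_systems (dipole n).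
    (\<lambda>(a, b). dipole_rotation a b) (\<lambda>i. fst (\<rho> (i, False)), \<lambda>i. fst (\<rho> (i, True))) = \<rho>"
  proof
    fix \<rho> assume \<rho>: "\<rho> \<in> rotation_systems (dipole n)"
    have "dipole_rotation (\<lambda>i. fst (\<rho> (i, False))) (\<lambda>i. fst (\<rho> (i, True))) (i, v) = \<rho> (i, v)" for i v
      using rotation_system_dipole_component(2)[OF assms \<rho>, of i v]
      by (cases v) (auto simp: dipole_rotation_def prod_eq_iff)
    then show "(\<lambda>(a, b). dipole_rotation a b)
      (\<lambda>i. fst (\<rho> (i, False)), \<lambda>i. fst (\<rho> (i, True))) = \<rho>" by (simp add: fun_eq_iff)
  qed
qed (use assms dipole_rotation_in_rotation_systems rotation_system_dipole_component(1)
    in \<open>auto simp: dipole_rotation_def\<close>)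

text \<open>Face tracing alternates between the two vertices: (i, False) -> (b i, True) -> (a (b i),
  False). A face is thus an orbit of \<open>a \<circ> b\<close> at one vertex together with its
  image under \<open>b\<close> at the other.\<close>

lemma card_faces_dipole_rotation:
  assumes n: "n > 0" and a: "a permutes {..<n}" and b: "b permutes {..<n}"
  shows "card (faces (dipole n) (dipole_rotation a b)) = num_cycles {..<n} (a \<circ> b)"
proof -
  let ?\<phi> = "dipole_rotation a b \<circ> dart_rev"
  let ?h = "\<lambda>X. X \<times> {False} \<union> b ` X \<times> {True}"
  have \<phi>: "?\<phi> (i, False) = (b i, True)" "?\<phi> (i, True) = (a i, False)" for i
    by (simp_all add: dipole_rotation_def dart_rev_def)
  have "permutation (a \<circ> b)"
    by (rule permutes_imp_permutation[OF _ permutes_compose[OF b a]]) simp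
  then have self: "i \<in> orbit (a \<circ> b) i" for i by (rule permutation_self_in_orbit)
  have orb: "orbit ?\<phi> (i, False) = ?h (orbit (a \<circ> b) i)" for i
  proof (intro equalityI subsetI)
    fix d assume "d \<in> orbit ?\<phi> (i, False)"
    then show "d \<in> ?h (orbit (a \<circ> b) i)"
    proof induction
      case base
      show ?case unfolding \<phi> using self by blast
    next
      case (step d)
      then consider k where "d = (k, False)" "k \<in> orbit (a \<circ> b) i"
        | k where "d = (b k, True)" "k \<in> orbit (a \<circ> b) i" by blast
      then show ?case
      proof cases
        case 1
        then have "?\<phi> d = (b k, True)" using \<phi>(1) by simp
        then show ?thesis using 1(2) by (simp only:) blast
      next
        case 2
        then have "?\<phi> d = ((a \<circ> b) k, False)" using \<phi>(2) by simp
        then show ?thesis using orbit.step[OF 2(2)] by (simp only:) blast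
      qed
    qed
  next
    have next_dart: "(b k, True) \<in> orbit ?\<phi> (i, False)" "((a \<circ> b) k, False) \<in> orbit ?\<phi> (i, False)"
      if "k = i \<or> (k, False) \<in> orbit ?\<phi> (i, False)" for k
    proof -
      have "?\<phi> (k, False) \<in> orbit ?\<phi> (i, False)"
        using that by (elim disjE) (simp only: orbit.base, rule orbit.step)
      then show 1: "(b k, True) \<in> orbit ?\<phi> (i, False)" by (simp only: \<phi>)
      show "((a \<circ> b) k, False) \<in> orbit ?\<phi> (i, False)"
        using orbit.step[OF 1] unfolding \<phi> by simp
    qed
    have F: "(k, False) \<in> orbit ?\<phi> (i, False)" if "k \<in> orbit (a \<circ> b) i" for k
      using that
    proof induction
      case base
      show ?case by (rule next_dart(2)) (rule disjI1[OF refl])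
    next
      case (step k)
      show ?case by (rule next_dart(2)) (rule disjI2[OF step.IH])
    qed
    fix d assume "d \<in> ?h (orbit (a \<circ> b) i)"
    then show "d \<in> orbit ?\<phi> (i, False)" using F next_dart(1) by blast
  qed
  have "faces (dipole n) (dipole_rotation a b) = orbit ?\<phi> ` ({..<n} \<times> UNIV)"
    using n unfolding faces_def darts_dipole by (auto simp: dipole_def)
  also have "\<dots> = ?h ` orbit (a \<circ> b) ` {..<n}"
  proof (intro equalityI subsetI)
    fix X assume "X \<in> orbit ?\<phi> ` ({..<n} \<times> UNIV)"
    then obtain i v where i: "i < n" "X = orbit ?\<phi> (i, v)" by auto
    show "X \<in> ?h ` orbit (a \<circ> b) ` {..<n}"
    proof (cases v)
      case False
      then show ?thesis using i orb by auto
    next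
      case True
      \<comment> \<open>The dart traced just before (i, True), so each face also starts at a dart of
        the vertex \<open>False\<close>.\<close>
      define j where "j = inv b i"
      have bj: "b j = i" unfolding j_def by (rule permutes_inverses(1)[OF b])
      have j: "j < n" using permutes_in_image[OF b, of j] i bj by simp
      have "orbit ?\<phi> (?\<phi> (j, False)) = orbit ?\<phi> (j, False)"
        by (rule self_in_orbit_step) (simp add: orb self)
      then have "X = orbit ?\<phi> (j, False)" using i True by (simp only: \<phi> bj)
      then show ?thesis using j orb by auto
    qed
  next
    fix X assume "X \<in> ?h ` orbit (a \<circ> b) ` {..<n}"
    then show "X \<in> orbit ?\<phi> ` ({..<n} \<times> UNIV)" using orb by auto
  qed
  finally have "card (faces (dipole n) (dipole_rotation a b)) = card (?h ` orbit (a \<circ> b) ` {..<n})" by simp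
  also have "inj ?h" by (rule injI) blast
  then have "card (?h ` orbit (a \<circ> b) ` {..<n}) = card (orbit (a \<circ> b) ` {..<n})"
    by (rule card_image[OF inj_on_subset[OF _ subset_UNIV]])
  finally show ?thesis by (simp add: num_cycles_def)
qed

text \<open>The genus is a natural number because \<open>a \<circ> b\<close> is even, so its number
  of cycles has the parity of n and is at most n.\<close>

lemma euler_char_dipole_rotation:
  assumes n: "n > 0" and a: "a \<in> full_cycles {..<n}" and b: "b \<in> full_cycles {..<n}"
  shows "\<exists>k. n = 2 * k + num_cycles {..<n} (a \<circ> b) \<and>
    euler_char (dipole n) (dipole_rotation a b) = 2 - 2 * int k"
proof -
  have pm: "a permutes {..<n}" "b permutes {..<n}" using a b by (auto simp: full_cycles_def)
  let ?c = "num_cycles {..<n} (a \<circ> b)"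
  have "?c \<le> n" using card_image_le[of "{..<n}" "orbit (a \<circ> b)"] by (simp add: num_cycles_def)
  moreover have "sign (a \<circ> b) = 1"
  proof (rule ccontr)
    assume "sign (a \<circ> b) \<noteq> 1"
    then have "num_fact {..<n} (a \<circ> b) = 0" by (rule num_fact_odd[rotated]) simp
    moreover have "finite {(a', b'). a' \<in> full_cycles {..<n} \<and> b' \<in> full_cycles {..<n} \<and> a' \<circ> b' = a \<circ> b}"
      by (rule finite_subset[of _ "full_cycles {..<n} \<times> full_cycles {..<n}"])
        (auto simp: finite_full_cycles)
    ultimately show False using a b by (auto simp: num_fact_def card_eq_0_iff)
  qed
  then have "even (n + ?c)"
    using sign_eq_num_cycles[of "{..<n}" "a \<circ> b"] permutes_compose[OF pm(2) pm(1)]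
    by (auto simp: minus_one_power_iff split: if_splits)
  ultimately obtain k where k: "n = 2 * k + ?c"
    by (metis even_add even_diff_nat evenE le_add_diff_inverse2)
  have "euler_char (dipole n) (dipole_rotation a b) = 2 - int n + int ?c"
    unfolding euler_char_def card_faces_dipole_rotation[OF n pm] by (simp add: dipole_def)
  then show ?thesis using k by (intro exI[of _ k]) linarith
qed

lemma average_genus_dipole:
  assumes n: "n > 0"
  shows "average_genus (dipole n) =
    (real n - harm (n + 1) - (-1) ^ n / (real n * real (n + 1))) / 2"
proof -
  let ?R = "rotation_systems (dipole n)" and ?F = "full_cycles {..<n}"
  \<comment> \<open>\<open>nat\<close> and \<open>div\<close> lose nothing here, since the Euler
    characteristic is even and at most 2.\<close>
  let ?g = "\<lambda>\<rho>. nat ((2 - euler_char (dipole n) \<rho>) div 2)"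
  note bij = bij_betw_dipole_rotation[OF n]
  have g: "2 * real (?g (dipole_rotation a b)) = real n - real (num_cycles {..<n} (a \<circ> b))"
      "euler_char (dipole n) (dipole_rotation a b) = 2 - 2 * int (?g (dipole_rotation a b))"
    if ab: "a \<in> ?F" "b \<in> ?F" for a b
  proof -
    obtain k where k: "n = 2 * k + num_cycles {..<n} (a \<circ> b)"
      "euler_char (dipole n) (dipole_rotation a b) = 2 - 2 * int k"
      using euler_char_dipole_rotation[OF n ab] by blast
    have "real n = real (2 * k + num_cycles {..<n} (a \<circ> b))" using k(1) by (rule arg_cong)
    then show "2 * real (?g (dipole_rotation a b)) = real n - real (num_cycles {..<n} (a \<circ> b))"
      "euler_char (dipole n) (dipole_rotation a b) = 2 - 2 * int (?g (dipole_rotation a b))"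
      using k(2) by simp_all
  qed
  have "average_genus (dipole n) = (\<Sum>\<rho>\<in>?R. real (?g \<rho>)) / real (card ?R)"
  proof (rule average_genus_eq_mean)
    show "finite (arcs (dipole n))" by (simp add: dipole_def)
    fix \<rho> assume "\<rho> \<in> ?R"
    then have "\<rho> \<in> (\<lambda>(a, b). dipole_rotation a b) ` (?F \<times> ?F)"
      using bij by (simp add: bij_betw_def)
    then obtain a b where "a \<in> ?F" "b \<in> ?F" "\<rho> = dipole_rotation a b" by auto
    then show "euler_char (dipole n) \<rho> = 2 - 2 * int (?g \<rho>)" using g(2) by blast
  qed
  also have "(\<Sum>\<rho>\<in>?R. real (?g \<rho>)) = (\<Sum>ab\<in>?F \<times> ?F. real (?g ((\<lambda>(a, b). dipole_rotation a b) ab)))"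
    by (rule sum.reindex_bij_betw[OF bij, symmetric])
  also have "\<dots> = (\<Sum>ab\<in>?F \<times> ?F. (real n - real (case ab of (a, b) \<Rightarrow> num_cycles {..<n} (a \<circ> b))) / 2)"
  proof (rule sum.cong[OF refl])
    fix ab assume "ab \<in> ?F \<times> ?F"
    then obtain a b where ab: "ab = (a, b)" "a \<in> ?F" "b \<in> ?F" by auto
    show "real (?g ((\<lambda>(a, b). dipole_rotation a b) ab)) =
      (real n - real (case ab of (a, b) \<Rightarrow> num_cycles {..<n} (a \<circ> b))) / 2"
      unfolding ab(1) prod.case g(1)[OF ab(2,3), symmetric] by simp
  qed
  also have "\<dots> = (real (card (?F \<times> ?F)) * real n - real (cycle_total {..<n})) / 2"
    by (simp add: cycle_total_def sum_divide_distrib[symmetric] sum_subtractf)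
  also have "card ?R = card (?F \<times> ?F)" using bij by (simp add: bij_betw_same_card)
  also have "card (?F \<times> ?F) = fact (n - 1) ^ 2"
    using card_full_cycles[of "{..<n}"] n by (simp add: card_cartesian_product power2_eq_square lessThan_empty_iff)
  also have "real (cycle_total {..<n}) = fact (n - 1) ^ 2 * (harm (n + 1) + (-1) ^ n / (real n * real (n + 1)))"
    using cycle_total_eq[of "{..<n}" n] n by (simp add: lessThan_empty_iff)
  also have "(real (fact (n - 1) ^ 2) * real n - fact (n - 1) ^ 2 * c) / 2 / real (fact (n - 1) ^ 2) = (real n - c) / 2"
    for c :: real
    by (simp add: field_simps)
  finally show ?thesis by (simp add: diff_diff_eq)
qed

section \<open>The closed form as a weighted sum, and its asymptotics\<close>

text \<open>Let F(n) be the closed form in \<open>average_genus_dipole\<close>. The weights n - m +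
  2 of the target sum \<open>c\<close> twice, so \<open>c m\<close> is the second difference F(m -
  1) - 2 F(m - 2) + F(m - 3). The value here is the first difference F(n + 1) - F(n), which starts
  at n = 1 with an empty sum.\<close>

lemma sum_telescope_dipole:
  defines "c \<equiv> \<lambda>m. (4 * (-1) ^ m * (real m)\<^sup>2 + (real m)\<^sup>2 - 12 * (-1) ^ m * real m - 5 * real m
             + 6 * (-1) ^ m + 6) / (2 * (real m - 3) * (real m - 2) * (real m - 1) * real m)"
  assumes "n \<ge> 1"
  shows "(\<Sum>m = 4..n + 2. c m) = (1 - 1 / real (n + 2) + (-1) ^ n *
    (1 / (real (n + 1) * real (n + 2)) + 1 / (real n * real (n + 1)))) / 2"
  using assms(2)
proof (induction n rule: dec_induct)
  case base
  show ?case by simp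
next
  case (step n)
  define x e where "x = real n" and "e = ((-1) ^ n :: real)"
  have x: "x \<ge> 1" using step by (simp add: x_def)
  have "(\<Sum>m = 4..Suc n + 2. c m) = (\<Sum>m = 4..n + 2. c m) + c (n + 3)"
    using step.hyps by (simp add: numeral_3_eq_3)
  also have "c (n + 3) = (- 4 * e * (x + 3)\<^sup>2 + (x + 3)\<^sup>2 + 12 * e * (x + 3) - 5 * (x + 3) - 6 * e + 6)
      / (2 * x * (x + 1) * (x + 2) * (x + 3))"
    by (simp add: c_def x_def e_def power_add algebra_simps)
  also have "(\<Sum>m = 4..n + 2. c m) = (1 - 1 / (x + 2) + e * (1 / ((x + 1) * (x + 2)) + 1 / (x * (x + 1)))) / 2"
    using step.IH by (simp add: x_def e_def algebra_simps)
  also have "\<dots> + (- 4 * e * (x + 3)\<^sup>2 + (x + 3)\<^sup>2 + 12 * e * (x + 3) - 5 * (x + 3) - 6 * e + 6)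
      / (2 * x * (x + 1) * (x + 2) * (x + 3))
    = (1 - 1 / (x + 3) - e * (1 / ((x + 2) * (x + 3)) + 1 / ((x + 1) * (x + 2)))) / 2"
  proof -
    have "x \<noteq> 0" "x + 1 \<noteq> 0" "x + 2 \<noteq> 0" "x + 3 \<noteq> 0" using x by auto
    then show ?thesis by (simp add: divide_simps) algebra
  qed
  also have "\<dots> = (1 - 1 / real (Suc n + 2) + (-1) ^ Suc n *
    (1 / (real (Suc n + 1) * real (Suc n + 2)) + 1 / (real (Suc n) * real (Suc n + 1)))) / 2"
    by (simp add: x_def e_def add_ac)
  finally show ?case .
qed

lemma dipole_closed_form_eq_sum:
  assumes "n \<ge> 1"
  shows "(real n - harm (n + 1) - (-1) ^ n / (real n * real (n + 1))) / 2 =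
    (\<Sum>m = 4..n + 1.
          (4 * (-1) ^ m * (real m)\<^sup>2 + (real m)\<^sup>2 - 12 * (-1) ^ m * real m - 5 * real m
             + 6 * (-1) ^ m + 6) * (real n - real m + 2)
          / (2 * (real m - 3) * (real m - 2) * (real m - 1) * real m))"
proof -
  define c where "c = (\<lambda>m. (4 * (-1) ^ m * (real m)\<^sup>2 + (real m)\<^sup>2 - 12 * (-1) ^ m * real m - 5 * real m
             + 6 * (-1) ^ m + 6) / (2 * (real m - 3) * (real m - 2) * (real m - 1) * real m))"
  have "(real n - harm (n + 1) - (-1) ^ n / (real n * real (n + 1))) / 2
    = (\<Sum>m = 4..n + 1. c m * (real n - real m + 2))"
    using assms
  proof (induction n rule: dec_induct)
    case base
    show ?case by (simp add: harm_Suc harm_expand(1))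
  next
    case (step n)
    have "(\<Sum>m = 4..Suc n + 1. c m * (real (Suc n) - real m + 2))
      = (\<Sum>m = 4..n + 2. c m * (real n - real m + 2) + c m)"
      by (intro sum.cong) (auto simp: algebra_simps)
    also have "\<dots> = (\<Sum>m = 4..n + 2. c m * (real n - real m + 2)) + (\<Sum>m = 4..n + 2. c m)"
      by (rule sum.distrib)
    \<comment> \<open>The weight at m = n + 2 is zero; for n = 1 both ranges are empty.\<close>
    also have "(\<Sum>m = 4..n + 2. c m * (real n - real m + 2)) = (\<Sum>m = 4..n + 1. c m * (real n - real m + 2))"
      by (cases "n = 1") simp_all
    also have "\<dots> = (real n - harm (n + 1) - (-1) ^ n / (real n * real (n + 1))) / 2"
      by (rule step.IH[symmetric])
    also have "(\<Sum>m = 4..n + 2. c m) = (1 - 1 / real (n + 2) + (-1) ^ n *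
        (1 / (real (n + 1) * real (n + 2)) + 1 / (real n * real (n + 1)))) / 2"
      unfolding c_def using step.hyps(1) by (rule sum_telescope_dipole)
    finally show ?case
      by (simp add: harm_Suc inverse_eq_divide add_divide_distrib diff_divide_distrib algebra_simps)
  qed
  also have "\<dots> = (\<Sum>m = 4..n + 1.
          (4 * (-1) ^ m * (real m)\<^sup>2 + (real m)\<^sup>2 - 12 * (-1) ^ m * real m - 5 * real m
             + 6 * (-1) ^ m + 6) * (real n - real m + 2)
          / (2 * (real m - 3) * (real m - 2) * (real m - 1) * real m))"
    by (rule sum.cong[OF refl]) (simp add: c_def)
  finally show ?thesis .
qed

lemma average_genus_dipole_asymp:
  "(\<lambda>n. average_genus (dipole n) - (real n - ln (real n) - euler_mascheroni) / 2) \<in> o(\<lambda>_. 1)"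
proof (rule smalloI_tendsto)
  \<comment> \<open>Splitting \<open>harm (n + 1)\<close> as \<open>harm n + 1 / (n + 1)\<close>
    exposes \<open>harm n - ln n\<close>, whose limit is the Euler constant.\<close>
  let ?r = "\<lambda>n. (- (harm n - ln (real n)) + euler_mascheroni - 1 / real (Suc n)
      - (-1) ^ n / (real n * real (Suc n))) / 2"
  have "(\<lambda>n. 1 / real (Suc n)) \<longlonglongrightarrow> 0"
    by (rule lim_1_over_n[THEN LIMSEQ_Suc])
  moreover have "(\<lambda>n. (-1) ^ n / (real n * real (Suc n))) \<longlonglongrightarrow> 0"
  proof (rule Lim_null_comparison)
    show "\<forall>\<^sub>F n in sequentially. norm ((-1) ^ n / (real n * real (Suc n))) \<le> 1 / real n"
      using eventually_gt_at_top[of 0]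
    proof eventually_elim
      case (elim n)
      have "norm ((-1) ^ n / (real n * real (Suc n))) = 1 / (real n * real (Suc n))"
        by (simp only: norm_divide norm_power norm_mult norm_of_nat norm_minus_cancel norm_one power_one)
      also have "\<dots> \<le> 1 / real n"
        using elim by (intro frac_le) simp_all
      finally show ?case .
    qed
  qed (rule lim_1_over_n)
  ultimately have "?r \<longlonglongrightarrow> (- euler_mascheroni + euler_mascheroni - 0 - 0) / 2"
    by (intro tendsto_intros euler_mascheroni_LIMSEQ) simp_all
  then have "?r \<longlonglongrightarrow> 0" by simp
  moreover have "\<forall>\<^sub>F n in sequentially.
    ?r n = (average_genus (dipole n) - (real n - ln (real n) - euler_mascheroni) / 2) / 1"
    using eventually_gt_at_top[of 0]
  proof eventually_elim
    case (elim n)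
    then show ?case
      by (simp add: average_genus_dipole harm_Suc inverse_eq_divide add_divide_distrib diff_divide_distrib)
  qed
  ultimately show "(\<lambda>n. (average_genus (dipole n) - (real n - ln (real n) - euler_mascheroni) / 2) / 1) \<longlonglongrightarrow> 0"
    by (rule Lim_transform_eventually)
qed simp

theorem theorem3p1:
  shows "average_genus (dipole 1) = 0 \<and> average_genus (dipole 2) = 0 \<and>
    (\<forall>n::nat. n \<ge> 3 \<longrightarrow>
      average_genus (dipole n) =
        (\<Sum>m = 4..n + 1.
          (4 * (-1) ^ m * (real m)\<^sup>2 + (real m)\<^sup>2 - 12 * (-1) ^ m * real m - 5 * real m
             + 6 * (-1) ^ m + 6) * (real n - real m + 2)
          / (2 * (real m - 3) * (real m - 2) * (real m - 1) * real m))) \<and>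
    (\<lambda>n::nat. average_genus (dipole n) - (real n - ln (real n) - euler_mascheroni) / 2)
      \<in> o(\<lambda>_. 1)"
proof (intro conjI allI impI)
  show "average_genus (dipole 1) = 0" "average_genus (dipole 2) = 0"
    using average_genus_dipole[of 1] average_genus_dipole[of 2]
    by (simp_all add: harm_def numeral_eq_Suc)
next
  fix n :: nat assume "n \<ge> 3"
  then show "average_genus (dipole n) =
        (\<Sum>m = 4..n + 1.
          (4 * (-1) ^ m * (real m)\<^sup>2 + (real m)\<^sup>2 - 12 * (-1) ^ m * real m - 5 * real m
             + 6 * (-1) ^ m + 6) * (real n - real m + 2)
          / (2 * (real m - 3) * (real m - 2) * (real m - 1) * real m))"
    by (intro trans[OF average_genus_dipole dipole_closed_form_eq_sum]) simp_all
qed (rule average_genus_dipole_asymp)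

end
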